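(* Consider the SUPER-ADAM algorithm with $\tau=0$ applied to $\min_{x\in\mathbb{R}^d} f(x)=\mathbb{E}_{\xi\sim\mathcal{D}}[f(x;\xi)]$ (that is, $\mathcal{X}=\mathbb{R}^d$). Assume: (1) there is $\sigma>0$ such that for all $x\in\mathbb{R}^d$, $\mathbb{E}[\nabla f(x;\xi)]=\nabla f(x)$ and $\mathbb{E}\|\nabla f(x;\xi)-\nabla f(x)\|^2\le\sigma^2$; (2) $f$ is bounded below, with $f^*=\inf_{x\in\mathbb{R}^d}f(x)>-\infty$; (3) there is $\rho>0$ such that $H_t\succeq\rho I_d$ for all $t\ge1$; (4) there is $L>0$ such that $\|\nabla f(x)-\nabla f(y)\|\le L\|x-y\|$ for all $x,y\in\mathbb{R}^d$. Let $k>0$, $m\ge k^2$, $\gamma=\frac{\rho m^{1/2}}{\nu Lk}$ with $\nu\ge8$, $\frac{8L\gamma}{\rho}\le c\le\frac{m^{1/2}}{k}$, and for all $t\ge0$ let $\mu_t=\frac{k}{(m+t)^{1/2}}$ and $\alpha_{t+1}=c\mu_t$. Then for every integer $T\ge1$, $$\frac1T\sum_{t=1}^T\mathbb{E}\|\nabla f(x_t)\|\le\frac{\sqrt{\frac1T\sum_{t=1}^T\mathbb{E}\|H_t\|^2}}{\rho}\left(\frac{2\sqrt{2M'}}{T^{1/2}}+\frac{2\sqrt{2M'}}{m^{1/4}T^{1/4}}\right),$$ where $M'=\nu L(f(x_1)-f^* )+2\nu\sigma^2+2\nu m\sigma^2\ln(m+T)$.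
   Context: Norms: $\|\cdot\|$ is the $\ell_2$ norm for vectors and the spectral norm for matrices. $f(\cdot;\xi)$ and $f$ are differentiable, and $f$ may be nonconvex; gradients are with respect to $x$. SUPER-ADAM algorithm (for a feasible set $\mathcal{X}$, here $\mathcal{X}=\mathbb{R}^d$). Inputs: $\tau\in\{0,1\}$, constant $\gamma>0$, parameters $\mu_t\in(0,1]$, $\alpha_{t+1}\in(0,1]$, and a deterministic starting point $x_1\in\mathcal{X}$. The samples $\xi_1,\xi_2,\dots$ are drawn independently from $\mathcal{D}$. Set $g_1=\nabla f(x_1;\xi_1)$. For $t=1,2,\dots$: (i) generate a symmetric matrix $H_t\in\mathbb{R}^{d\times d}$ by any rule depending (measurably) only on the information available so far, i.e. on $\xi_1,\dots,\xi_t$; (ii) $\tilde{x}_{t+1}=\arg\min_{x\in\mathcal{X}}\{\langle g_t,x\rangle+\frac{1}{2\gamma}(x-x_t)^TH_t(x-x_t)\}$; (iii) $x_{t+1}=(1-\mu_t)x_t+\mu_t\tilde{x}_{t+1}$; (iv) draw $\xi_{t+1}$ and set $g_{t+1}=\alpha_{t+1}\nabla f(x_{t+1};\xi_{t+1})+(1-\alpha_{t+1})\big[g_t+\tau\big(\nabla f(x_{t+1};\xi_{t+1})-\nabla f(x_t;\xi_{t+1})\big)\big]$ (so for $\tau=0$, $g_{t+1}=\alpha_{t+1}\nabla f(x_{t+1};\xi_{t+1})+(1-\alpha_{t+1})g_t$). $\mathbb{E}$ denotes expectation over all the samples; the right-hand side of the bound is allowed to be $+\infty$. *)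

theory Defs
  imports "HOL-Probability.Probability"
begin

definition gradient :: "('a::real_inner \<Rightarrow> real) \<Rightarrow> 'a \<Rightarrow> 'a" where
  "gradient f x = (THE v. GDERIV f x :> v)"

(* The norm on real ^ 'n ^ 'm provided by the library is the Frobenius norm. *)
definition spectral_norm :: "real ^ 'n ^ 'm \<Rightarrow> real" where
  "spectral_norm A = onorm (\<lambda>v. A *v v)"

definition pos_semidef :: "real ^ 'n ^ 'n \<Rightarrow> bool" where
  "pos_semidef A \<longleftrightarrow> transpose A = A \<and> (\<forall>v. 0 \<le> v \<bullet> (A *v v))"

definition ennreal_sqrt :: "ennreal \<Rightarrow> ennreal" where
  "ennreal_sqrt a = (if a = \<infinity> then \<infinity> else ennreal (sqrt (enn2real a)))"

(* M is the underlying probability space, xi t the samples, D their common law, F y s the sampled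
   loss f(y; s) and xt (t + 1) the minimiser x-tilde in step t. The matrices H t are produced by an
   arbitrary measurable rule h from the samples 1, ..., t; the iterates x t and estimators g t are
   themselves determined by these samples. The index 0 of the sequences is not used, except for
   that of alpha and mu in the choice of parameters. *)
locale super_adam = prob_space M
  for M :: "'w measure" +
  fixes D :: "'s measure"
    and F :: "real ^ 'd \<Rightarrow> 's \<Rightarrow> real"
    and X :: "(real ^ 'd) set"
    and \<tau> \<gamma> :: real
    and \<mu> \<alpha> :: "nat \<Rightarrow> real"
    and x1 :: "real ^ 'd"
    and \<xi> :: "nat \<Rightarrow> 'w \<Rightarrow> 's"
    and H :: "nat \<Rightarrow> 'w \<Rightarrow> real ^ 'd ^ 'd"
    and xt x g :: "nat \<Rightarrow> 'w \<Rightarrow> real ^ 'd"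
  assumes tau: "\<tau> \<in> {0, 1}"
    and gamma: "\<gamma> > 0"
    and mu: "\<And>t. t \<ge> 1 \<Longrightarrow> \<mu> t \<in> {0<..1}"
    and alpha: "\<And>t. t \<ge> 1 \<Longrightarrow> \<alpha> (t + 1) \<in> {0<..1}"
    and start_feasible: "x1 \<in> X"
    and samples_indep: "indep_vars (\<lambda>_. D) \<xi> {1..}"
    and samples_law: "\<And>t. t \<ge> 1 \<Longrightarrow> distr M D (\<xi> t) = D"
    and x_start: "\<And>\<omega>. \<omega> \<in> space M \<Longrightarrow> x 1 \<omega> = x1"
    and g_start: "\<And>\<omega>. \<omega> \<in> space M \<Longrightarrow> g 1 \<omega> = gradient (\<lambda>y. F y (\<xi> 1 \<omega>)) (x 1 \<omega>)"
    and H_symmetric: "\<And>t \<omega>. t \<ge> 1 \<Longrightarrow> \<omega> \<in> space M \<Longrightarrow> transpose (H t \<omega>) = H t \<omega>"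
    and H_rule: "\<And>t. t \<ge> 1 \<Longrightarrow>
      \<exists>h \<in> borel_measurable (Pi\<^sub>M {1..t} (\<lambda>_. D)).
        \<forall>\<omega> \<in> space M. H t \<omega> = h (\<lambda>i \<in> {1..t}. \<xi> i \<omega>)"
    and xt_step: "\<And>t \<omega>. t \<ge> 1 \<Longrightarrow> \<omega> \<in> space M \<Longrightarrow>
      is_arg_min
        (\<lambda>y. g t \<omega> \<bullet> y + 1 / (2 * \<gamma>) * ((y - x t \<omega>) \<bullet> (H t \<omega> *v (y - x t \<omega>))))
        (\<lambda>y. y \<in> X) (xt (t + 1) \<omega>)"
    and x_step: "\<And>t \<omega>. t \<ge> 1 \<Longrightarrow> \<omega> \<in> space M \<Longrightarrow>
      x (t + 1) \<omega> = (1 - \<mu> t) *\<^sub>R x t \<omega> + \<mu> t *\<^sub>R xt (t + 1) \<omega>"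
    and g_step: "\<And>t \<omega>. t \<ge> 1 \<Longrightarrow> \<omega> \<in> space M \<Longrightarrow>
      g (t + 1) \<omega> =
        \<alpha> (t + 1) *\<^sub>R gradient (\<lambda>y. F y (\<xi> (t + 1) \<omega>)) (x (t + 1) \<omega>)
        + (1 - \<alpha> (t + 1)) *\<^sub>R
            (g t \<omega> + \<tau> *\<^sub>R (gradient (\<lambda>y. F y (\<xi> (t + 1) \<omega>)) (x (t + 1) \<omega>)
                          - gradient (\<lambda>y. F y (\<xi> (t + 1) \<omega>)) (x t \<omega>)))"

end

theory Submission
  imports Defs
begin

text \<open>Write \<open>e\<^sub>t = \<nabla>f(x\<^sub>t) - g\<^sub>t\<close> and \<open>d\<^sub>t\<close> for the search direction, so that \<open>H\<^sub>t d\<^sub>t = -\<gamma> g\<^sub>t\<close>.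
  Smoothness and \<open>H\<^sub>t \<ge> \<rho>\<close> make \<open>f\<close> decrease along the iterates up to a multiple of \<open>\<parallel>e\<^sub>t\<parallel>\<^sup>2\<close>, while
  independence of the fresh sample makes \<open>\<parallel>e\<^sub>t\<parallel>\<^sup>2\<close> contract in mean by the factor \<open>1 - \<alpha>\<^sub>t\<^sub>+\<^sub>1\<close> up to
  a multiple of \<open>\<parallel>d\<^sub>t\<parallel>\<^sup>2\<close> and the noise \<open>\<alpha>\<^sub>t\<^sub>+\<^sub>1\<^sup>2 \<sigma>\<^sup>2\<close>. Hence \<open>E (f(x\<^sub>t) - f\<^sup>*) + E \<parallel>e\<^sub>t\<parallel>\<^sup>2 / L\<close> is a potential
  that absorbs both error terms, and telescoping bounds the sum of
  \<open>E (\<gamma>/\<rho> \<parallel>e\<^sub>t\<parallel>\<^sup>2 + \<rho>/\<gamma> \<parallel>d\<^sub>t\<parallel>\<^sup>2)\<close>. The claim follows by Cauchy-Schwarz from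
  \<open>\<parallel>\<nabla>f(x\<^sub>t)\<parallel> \<le> \<parallel>e\<^sub>t\<parallel> + \<parallel>H\<^sub>t d\<^sub>t\<parallel>/\<gamma> \<le> \<parallel>H\<^sub>t\<parallel> (\<parallel>e\<^sub>t\<parallel>/\<rho> + \<parallel>d\<^sub>t\<parallel>/\<gamma>)\<close>. Every quantity is nonnegative, so
  all expectations can be taken in the extended nonnegative reals and no integrability has to be
  established.\<close>

subsection \<open>Gradients\<close>

text \<open>\<open>gradient\<close> is a definite description, so existence and uniqueness both
  matter. Existence is Riesz representation in coordinates: a linear functional is the inner product
  with the vector of its values on the basis. For uniqueness, two candidates are tested on their
  difference.\<close>

lemma gderiv_gradient:
  fixes f :: "'a::euclidean_space \<Rightarrow> real"
  assumes "f differentiable (at x)"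
  shows "GDERIV f x :> gradient f x"
proof -
  obtain f' where f': "(f has_derivative f') (at x)"
    using assms by (auto simp: differentiable_def)
  then interpret bounded_linear f' by (rule has_derivative_bounded_linear)
  have "f' = (\<lambda>h. inner h (\<Sum>b\<in>Basis. f' b *\<^sub>R b))"
  proof
    fix h
    have "f' h = f' (\<Sum>b\<in>Basis. (h \<bullet> b) *\<^sub>R b)" by (simp add: euclidean_representation)
    also have "\<dots> = inner h (\<Sum>b\<in>Basis. f' b *\<^sub>R b)"
      by (simp add: sum scaleR inner_sum_right mult.commute)
    finally show "f' h = inner h (\<Sum>b\<in>Basis. f' b *\<^sub>R b)" .
  qed
  with f' have ex: "GDERIV f x :> (\<Sum>b\<in>Basis. f' b *\<^sub>R b)"
    by (simp add: gderiv_def)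
  have uniq: "v = w" if "GDERIV f x :> v" "GDERIV f x :> w" for v w
  proof -
    have "(\<lambda>h. inner h v) = (\<lambda>h. inner h w)"
      using that has_derivative_unique unfolding gderiv_def by blast
    then have "inner (v - w) v = inner (v - w) w" by meson
    then have "inner (v - w) (v - w) = 0" by (simp add: inner_diff_right)
    then show ?thesis by simp
  qed
  show ?thesis
    unfolding gradient_def by (rule theI[of _ "\<Sum>b\<in>Basis. f' b *\<^sub>R b"]) (use ex uniq in auto)
qed

lemma gradient_directional_derivative:
  fixes f :: "'a::euclidean_space \<Rightarrow> real"
  assumes "f differentiable (at (x + s *\<^sub>R d))"
  shows "((\<lambda>s. f (x + s *\<^sub>R d)) has_real_derivative gradient f (x + s *\<^sub>R d) \<bullet> d) (at s)"
proof -
  have "(f has_derivative (\<lambda>h. inner h (gradient f (x + s *\<^sub>R d)))) (at (x + s *\<^sub>R d))"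
    using gderiv_gradient[OF assms] by (simp add: gderiv_def)
  moreover have "((\<lambda>s. x + s *\<^sub>R d) has_derivative (\<lambda>h. h *\<^sub>R d)) (at s)"
    by (auto intro!: derivative_eq_intros)
  ultimately have "((\<lambda>s. f (x + s *\<^sub>R d)) has_derivative
      (\<lambda>h. inner (h *\<^sub>R d) (gradient f (x + s *\<^sub>R d)))) (at s)"
    by (rule has_derivative_compose[rotated])
  then show ?thesis
    by (simp add: has_field_derivative_def inner_commute mult_commute_abs)
qed

text \<open>The descent lemma, obtained from monotonicity instead of integration: along the segment
  the gap \<psi> between f and its quadratic model has a derivative that Cauchy-Schwarz and the
  Lipschitz bound make nonpositive.\<close>

lemma lipschitz_gradient_upper_bound:
  fixes f :: "'a::euclidean_space \<Rightarrow> real"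
  assumes diff: "\<And>y. f differentiable (at y)"
    and lip: "\<And>y z. norm (gradient f y - gradient f z) \<le> L * norm (y - z)"
  shows "f (x + d) \<le> f x + gradient f x \<bullet> d + L / 2 * (norm d)\<^sup>2"
proof -
  define \<psi> where "\<psi> s = f (x + s *\<^sub>R d) - s * (gradient f x \<bullet> d) - L / 2 * s\<^sup>2 * (norm d)\<^sup>2" for s
  have "\<psi> 1 \<le> \<psi> 0"
  proof (rule DERIV_nonpos_imp_nonincreasing[where f = \<psi>])
    fix s :: real assume s: "0 \<le> s"
    have "(\<psi> has_real_derivative
      gradient f (x + s *\<^sub>R d) \<bullet> d - gradient f x \<bullet> d - L * s * (norm d)\<^sup>2) (at s)"
      unfolding \<psi>_def
      by (rule derivative_eq_intros gradient_directional_derivative diff refl | simp)+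
    moreover have "(gradient f (x + s *\<^sub>R d) - gradient f x) \<bullet> d \<le> L * s * (norm d)\<^sup>2"
    proof -
      have "(gradient f (x + s *\<^sub>R d) - gradient f x) \<bullet> d
          \<le> norm (gradient f (x + s *\<^sub>R d) - gradient f x) * norm d"
        by (rule norm_cauchy_schwarz)
      also have "\<dots> \<le> (L * norm (x + s *\<^sub>R d - x)) * norm d"
        by (intro mult_right_mono lip) auto
      finally show ?thesis using s by (simp add: power2_eq_square mult_ac)
    qed
    ultimately show "\<exists>y. (\<psi> has_real_derivative y) (at s) \<and> y \<le> 0"
      by (auto simp: inner_diff_left)
  qed simp
  then show ?thesis by (simp add: \<psi>_def)
qed

text \<open>Caratheodory functions are jointly measurable: the point is approximated by simple
  functions \<open>r i\<close>, each taking finitely many values, so substituting them is a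
  countable case distinction; continuity in the point then passes measurability to the
  limit.\<close>

lemma borel_measurable_pair_caratheodory:
  fixes F :: "'a::{metric_space, second_countable_topology} \<Rightarrow> 's \<Rightarrow> real"
  assumes meas: "\<And>y. F y \<in> borel_measurable D"
    and cont: "\<And>s. s \<in> space D \<Longrightarrow> continuous_on UNIV (\<lambda>y. F y s)"
  shows "(\<lambda>p. F (fst p) (snd p)) \<in> borel_measurable (borel \<Otimes>\<^sub>M D)"
proof -
  obtain r :: "nat \<Rightarrow> 'a \<Rightarrow> 'a" where r: "\<And>i. simple_function borel (r i)" "\<And>y. (\<lambda>i. r i y) \<longlonglongrightarrow> y"
    using borel_measurable_implies_sequence_metric[of "\<lambda>y::'a. y" borel undefined] by auto
  have "(\<lambda>p. F (r i (fst p)) (snd p)) \<in> borel_measurable (borel \<Otimes>\<^sub>M D)" for i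
  proof (rule measurable_compose_countable'[where f = "\<lambda>y p. F y (snd p)" and I = "range (r i)"])
    show "(\<lambda>p. F y (snd p)) \<in> borel_measurable (borel \<Otimes>\<^sub>M D)" for y
      using meas by measurable
    show "countable (range (r i))"
      using simple_functionD(1)[OF r(1)] by (auto intro: countable_finite)
    have "(\<lambda>p. r i (fst p)) \<in> borel \<Otimes>\<^sub>M D \<rightarrow>\<^sub>M count_space UNIV"
      using measurable_simple_function[OF r(1)] by measurable
    then show "(\<lambda>p. r i (fst p)) \<in> borel \<Otimes>\<^sub>M D \<rightarrow>\<^sub>M count_space (range (r i))"
      by (auto simp: measurable_count_space_eq2_countable measurable_def space_pair_measure
          intro!: measurable_count_space_extend)
  qed
  moreover have "(\<lambda>i. F (r i (fst p)) (snd p)) \<longlonglongrightarrow> F (fst p) (snd p)"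
    if "p \<in> space (borel \<Otimes>\<^sub>M D)" for p
  proof -
    have "isCont (\<lambda>y. F y (snd p)) (fst p)"
      using cont that by (auto simp: space_pair_measure continuous_on_eq_continuous_at)
    then show ?thesis
      using r(2) by (rule isCont_tendsto_compose)
  qed
  ultimately show ?thesis by (rule borel_measurable_LIMSEQ_metric)
qed

text \<open>Joint measurability matters because sampled gradients are evaluated at random iterates.
  Each directional component is the limit of difference quotients with steps 1/(i+1).\<close>

lemma borel_measurable_gradient_pair:
  fixes F :: "'a::euclidean_space \<Rightarrow> 's \<Rightarrow> real"
  assumes meas: "\<And>y. F y \<in> borel_measurable D"
    and diff: "\<And>s y. s \<in> space D \<Longrightarrow> (\<lambda>z. F z s) differentiable (at y)"
  shows "(\<lambda>p. gradient (\<lambda>z. F z (snd p)) (fst p)) \<in> borel_measurable (borel \<Otimes>\<^sub>M D)"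
proof -
  have F [measurable]: "(\<lambda>p. F (fst p) (snd p)) \<in> borel_measurable (borel \<Otimes>\<^sub>M D)"
    using meas diff
    by (intro borel_measurable_pair_caratheodory)
       (auto intro!: differentiable_imp_continuous_on simp: differentiable_on_def)
  have "(\<lambda>p. gradient (\<lambda>z. F z (snd p)) (fst p) \<bullet> b) \<in> borel_measurable (borel \<Otimes>\<^sub>M D)" for b
  proof (rule borel_measurable_LIMSEQ_metric)
    fix i
    have [measurable]: "(\<lambda>p. (fst p + inverse (real (Suc i)) *\<^sub>R b, snd p)) \<in> borel \<Otimes>\<^sub>M D \<rightarrow>\<^sub>M borel \<Otimes>\<^sub>M D"
      by measurable
    have "(\<lambda>p. F (fst p + inverse (real (Suc i)) *\<^sub>R b) (snd p)) \<in> borel_measurable (borel \<Otimes>\<^sub>M D)"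
      using measurable_compose[OF _ F, of "\<lambda>p. (fst p + inverse (real (Suc i)) *\<^sub>R b, snd p)"] by simp
    then show "(\<lambda>p. (F (fst p + inverse (real (Suc i)) *\<^sub>R b) (snd p) - F (fst p) (snd p))
        / inverse (real (Suc i))) \<in> borel_measurable (borel \<Otimes>\<^sub>M D)"
      by measurable
  next
    fix p assume "p \<in> space (borel \<Otimes>\<^sub>M D :: ('a \<times> 's) measure)"
    then have "(\<lambda>z. F z (snd p)) differentiable (at (fst p + 0 *\<^sub>R b))"
      using diff by (auto simp: space_pair_measure)
    from gradient_directional_derivative[OF this]
    have lim: "((\<lambda>h. (F (fst p + h *\<^sub>R b) (snd p) - F (fst p) (snd p)) / h)
        \<longlongrightarrow> gradient (\<lambda>z. F z (snd p)) (fst p) \<bullet> b) (at 0)"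
      by (simp add: DERIV_def)
    have "filterlim (\<lambda>i. inverse (real (Suc i))) (at 0) sequentially"
      using LIMSEQ_inverse_real_of_nat by (simp add: filterlim_at)
    from filterlim_compose[OF lim this]
    show "(\<lambda>i. (F (fst p + inverse (real (Suc i)) *\<^sub>R b) (snd p) - F (fst p) (snd p))
        / inverse (real (Suc i))) \<longlonglongrightarrow> gradient (\<lambda>z. F z (snd p)) (fst p) \<bullet> b" .
  qed
  then show ?thesis by (subst borel_measurable_euclidean_space) auto
qed

subsection \<open>Quadratic models and the spectral norm\<close>

lemma real_linear_quadratic_nonneg:
  fixes a b :: real
  assumes "\<And>s. 0 \<le> s * b + s\<^sup>2 * a"
  shows "b = 0"
proof (rule ccontr)
  assume "b \<noteq> 0"
  \<comment> \<open>This \<open>s\<close> has the sign opposite to \<open>b\<close> and is small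
    enough that the linear term wins: scaled by the square of \<open>\<bar>a\<bar> + 1\<close>, the
    expression becomes the negative number
    \<open>b\<^sup>2 * (a - \<bar>a\<bar> - 1)\<close>.\<close>
  define s where "s = - b / (\<bar>a\<bar> + 1)"
  have "(\<bar>a\<bar> + 1) * s = - b" by (simp add: s_def)
  moreover have "(\<bar>a\<bar> + 1)\<^sup>2 * (s * b + s\<^sup>2 * a)
      = (\<bar>a\<bar> + 1) * ((\<bar>a\<bar> + 1) * s) * b + ((\<bar>a\<bar> + 1) * s)\<^sup>2 * a"
    by (simp add: algebra_simps power2_eq_square)
  ultimately have "(\<bar>a\<bar> + 1)\<^sup>2 * (s * b + s\<^sup>2 * a) = (\<bar>a\<bar> + 1) * (- b) * b + (- b)\<^sup>2 * a"
    by (simp only:)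
  also have "\<dots> = b\<^sup>2 * (a - \<bar>a\<bar> - 1)"
    by (simp add: algebra_simps power2_eq_square)
  finally have eq: "(\<bar>a\<bar> + 1)\<^sup>2 * (s * b + s\<^sup>2 * a) = b\<^sup>2 * (a - \<bar>a\<bar> - 1)" .
  have "0 \<le> (\<bar>a\<bar> + 1)\<^sup>2 * (s * b + s\<^sup>2 * a)" using assms by auto
  moreover have "b\<^sup>2 * (a - \<bar>a\<bar> - 1) < 0" using \<open>b \<noteq> 0\<close> by (intro mult_pos_neg) auto
  ultimately show False unfolding eq by simp
qed

lemma inner_matrix_symmetric:
  fixes A :: "real ^ 'n ^ 'n"
  assumes "transpose A = A"
  shows "v \<bullet> (A *v w) = w \<bullet> (A *v v)"
  by (metis assms dot_lmul_matrix inner_commute transpose_matrix_vector)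

text \<open>First-order optimality without differentiation. The vector \<open>v\<close> is the
  gradient of the model at the minimiser; a move by \<open>s *\<^sub>R v\<close> changes the model
  by s times the squared norm of \<open>v\<close> plus a term quadratic in s, where symmetry merges
  the cross terms. Minimality for every s forces \<open>v = 0\<close>.\<close>

lemma is_arg_min_quadratic_model:
  fixes A :: "real ^ 'n ^ 'n"
  assumes min: "is_arg_min (\<lambda>y. g \<bullet> y + 1 / (2 * \<gamma>) * ((y - x) \<bullet> (A *v (y - x)))) (\<lambda>y. y \<in> UNIV) z"
    and sym: "transpose A = A" and pos: "\<gamma> > 0"
  shows "A *v (z - x) = - \<gamma> *\<^sub>R g"
proof -
  define d where "d = z - x"
  define v where "v = g + (1 / \<gamma>) *\<^sub>R (A *v d)"
  have "0 \<le> s * (v \<bullet> v) + s\<^sup>2 * (1 / (2 * \<gamma>) * (v \<bullet> (A *v v)))" for s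
  proof -
    have "g \<bullet> z + 1 / (2 * \<gamma>) * (d \<bullet> (A *v d))
        \<le> g \<bullet> (z + s *\<^sub>R v) + 1 / (2 * \<gamma>) * ((d + s *\<^sub>R v) \<bullet> (A *v (d + s *\<^sub>R v)))"
    proof -
      have "z + s *\<^sub>R v - x = d + s *\<^sub>R v" by (simp add: d_def)
      with min show ?thesis unfolding is_arg_min_linorder d_def by (metis UNIV_I)
    qed
    also have "(d + s *\<^sub>R v) \<bullet> (A *v (d + s *\<^sub>R v))
        = d \<bullet> (A *v d) + 2 * s * (v \<bullet> (A *v d)) + s\<^sup>2 * (v \<bullet> (A *v v))"
      using inner_matrix_symmetric[OF sym, of d v]
      by (simp add: matrix_vector_right_distrib matrix_vector_mult_scaleR inner_simps
          power2_eq_square algebra_simps)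
    also have "1 / (2 * \<gamma>) * (d \<bullet> (A *v d) + 2 * s * (v \<bullet> (A *v d)) + s\<^sup>2 * (v \<bullet> (A *v v)))
        = 1 / (2 * \<gamma>) * (d \<bullet> (A *v d)) + s * ((1 / \<gamma>) * (v \<bullet> (A *v d)))
          + s\<^sup>2 * (1 / (2 * \<gamma>) * (v \<bullet> (A *v v)))"
      using pos by (simp add: field_simps)
    finally have "0 \<le> s * (g \<bullet> v + (1 / \<gamma>) * (v \<bullet> (A *v d))) + s\<^sup>2 * (1 / (2 * \<gamma>) * (v \<bullet> (A *v v)))"
      by (simp add: inner_simps distrib_left)
    also have "g \<bullet> v + (1 / \<gamma>) * (v \<bullet> (A *v d)) = v \<bullet> v"
      by (subst (4) v_def) (simp add: inner_simps inner_commute)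
    finally show ?thesis .
  qed
  then have "v \<bullet> v = 0" by (rule real_linear_quadratic_nonneg)
  then have "\<gamma> *\<^sub>R v = 0" by simp
  then show ?thesis using pos by (simp add: v_def d_def algebra_simps eq_neg_iff_add_eq_0)
qed

lemma pos_semidef_diff_scaleR_mat:
  assumes "pos_semidef (A - \<rho> *\<^sub>R mat 1)"
  shows "\<rho> * (norm v)\<^sup>2 \<le> v \<bullet> (A *v v)"
proof -
  have "0 \<le> v \<bullet> ((A - \<rho> *\<^sub>R mat 1) *v v)" using assms by (auto simp: pos_semidef_def)
  then show ?thesis
    by (simp add: matrix_vector_mult_diff_rdistrib inner_simps power2_norm_eq_inner
        flip: scaleR_matrix_vector_assoc)
qed

lemma norm_matrix_vector_le_spectral_norm: "norm (A *v v) \<le> spectral_norm A * norm v"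
  unfolding spectral_norm_def by (intro onorm matrix_vector_mul_bounded_linear)

text \<open>One unit vector suffices as a test. The bound later puts the factor
  \<open>spectral_norm A / \<rho>\<close> in front of a bare error term and keeps the second moments
  of the norms away from zero.\<close>

lemma spectral_norm_ge:
  assumes "pos_semidef (A - \<rho> *\<^sub>R mat 1)"
  shows "\<rho> \<le> spectral_norm A"
proof -
  define v :: "real ^ 'a" where "v = axis undefined 1"
  have v: "norm v = 1" by (simp add: v_def)
  have "\<rho> \<le> v \<bullet> (A *v v)" using pos_semidef_diff_scaleR_mat[OF assms, of v] v by simp
  also have "\<dots> \<le> norm v * norm (A *v v)" by (rule norm_cauchy_schwarz)
  also have "\<dots> \<le> spectral_norm A" using norm_matrix_vector_le_spectral_norm[of A v] v by simp
  finally show ?thesis .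
qed

text \<open>Serves the measurability of the norms of \<open>H t\<close>. A finite convex function on
  a finite-dimensional space is continuous, and convexity comes from the triangle inequality and
  homogeneity of the operator norm.\<close>

lemma continuous_on_spectral_norm: "continuous_on UNIV (spectral_norm :: real ^ 'n ^ 'm \<Rightarrow> real)"
proof (rule convex_on_continuous)
  show "convex_on UNIV (spectral_norm :: real ^ 'n ^ 'm \<Rightarrow> real)"
  proof (rule convex_onI)
    fix t :: real and A B :: "real ^ 'n ^ 'm" assume t: "0 < t" "t < 1"
    have "spectral_norm ((1 - t) *\<^sub>R A + t *\<^sub>R B)
        = onorm (\<lambda>v. (1 - t) *\<^sub>R (A *v v) + t *\<^sub>R (B *v v))"
      by (simp add: spectral_norm_def matrix_vector_mult_add_rdistrib scaleR_matrix_vector_assoc)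
    also have "\<dots> \<le> onorm (\<lambda>v. (1 - t) *\<^sub>R (A *v v)) + onorm (\<lambda>v. t *\<^sub>R (B *v v))"
      by (intro onorm_triangle bounded_linear_scaleR_right[THEN bounded_linear_compose]
          matrix_vector_mul_bounded_linear)
    also have "\<dots> = (1 - t) * spectral_norm A + t * spectral_norm B"
      using t by (simp add: onorm_scaleR matrix_vector_mul_bounded_linear spectral_norm_def)
    finally show "spectral_norm ((1 - t) *\<^sub>R A + t *\<^sub>R B) \<le> (1 - t) * spectral_norm A + t * spectral_norm B" .
  qed simp
qed simp

text \<open>Cramer's rule gives the solution of a linear system as a quotient of polynomials in the
  data, hence measurably. This is how the search direction inherits measurability from
  \<open>H t\<close> and \<open>g t\<close>.\<close>

lemma borel_measurable_cramer:
  fixes A :: "'a \<Rightarrow> real ^ 'n ^ 'n" and b :: "'a \<Rightarrow> real ^ 'n"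
  assumes "A \<in> borel_measurable M" "b \<in> borel_measurable M"
  shows "(\<lambda>w. \<chi> k. det (\<chi> i j. if j = k then b w $ i else A w $ i $ j) / det (A w)) \<in> borel_measurable M"
proof -
  have A [measurable]: "(\<lambda>w. A w $ i $ j) \<in> borel_measurable M" for i j
    by (rule measurable_compose[OF assms(1)]) (intro borel_measurable_continuous_onI continuous_intros)
  have b [measurable]: "(\<lambda>w. b w $ i) \<in> borel_measurable M" for i
    by (rule measurable_compose[OF assms(2)]) (intro borel_measurable_continuous_onI continuous_intros)
  show ?thesis
    by (subst borel_measurable_euclidean_space)
       (auto simp: Basis_vec_def inner_axis det_def intro!: borel_measurable_divide borel_measurable_sum
         borel_measurable_times borel_measurable_prod)
qed

subsection \<open>Mean-square bounds and elementary estimates\<close>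

text \<open>In the expanded square the cross term has mean zero because the noise is centred. The
  bound on the extended integral first yields square integrability, so the expansion can be
  integrated over the reals.\<close>

lemma (in prob_space) nn_integral_norm_add_scaleR_noise:
  fixes Z :: "'a \<Rightarrow> 'b::euclidean_space"
  assumes Z: "integrable M Z" "expectation Z = 0"
    and var: "(\<integral>\<^sup>+s. ennreal ((norm (Z s))\<^sup>2) \<partial>M) \<le> ennreal v" and "0 \<le> v"
  shows "(\<integral>\<^sup>+s. ennreal ((norm (a + r *\<^sub>R Z s))\<^sup>2) \<partial>M) \<le> ennreal ((norm a)\<^sup>2 + r\<^sup>2 * v)"
proof -
  have [measurable]: "Z \<in> borel_measurable M" using Z by auto
  have fin: "(\<integral>\<^sup>+s. ennreal ((norm (Z s))\<^sup>2) \<partial>M) < \<infinity>"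
    using var by (rule order.strict_trans1) simp
  have int2: "integrable M (\<lambda>s. (norm (Z s))\<^sup>2)"
    by (rule integrableI_nonneg) (use fin in auto)
  have expand: "(norm (a + r *\<^sub>R Z s))\<^sup>2 = (norm a)\<^sup>2 + 2 * r * (a \<bullet> Z s) + r\<^sup>2 * (norm (Z s))\<^sup>2" for s
    unfolding power2_norm_eq_inner by (simp add: inner_simps inner_commute power2_eq_square)
  have int: "integrable M (\<lambda>s. (norm (a + r *\<^sub>R Z s))\<^sup>2)"
    unfolding expand using Z int2 by auto
  have "expectation (\<lambda>s. (norm (a + r *\<^sub>R Z s))\<^sup>2)
      = (norm a)\<^sup>2 + r\<^sup>2 * expectation (\<lambda>s. (norm (Z s))\<^sup>2)"
    unfolding expand using Z int2 by (simp add: prob_space)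
  also have "\<dots> \<le> (norm a)\<^sup>2 + r\<^sup>2 * v"
  proof -
    have "ennreal (expectation (\<lambda>s. (norm (Z s))\<^sup>2)) \<le> ennreal v"
      using var int2 by (simp add: nn_integral_eq_integral)
    then show ?thesis using \<open>0 \<le> v\<close> by (auto intro: mult_left_mono)
  qed
  finally show ?thesis
    using int by (simp add: nn_integral_eq_integral ennreal_leI)
qed

text \<open>Cauchy-Schwarz for sum and expectation at once. Young's inequality is applied pointwise
  with a single weight for all terms, which keeps everything inside extended nonnegative integrals;
  strict positivity of \<open>a\<close> and \<open>b\<close> makes the optimal weight positive and
  finite.\<close>

lemma sum_nn_integral_mult_le:
  fixes h w :: "'i \<Rightarrow> 'a \<Rightarrow> real"
  assumes meas: "\<And>i. i \<in> A \<Longrightarrow> h i \<in> borel_measurable M" "\<And>i. i \<in> A \<Longrightarrow> w i \<in> borel_measurable M"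
    and h: "(\<Sum>i\<in>A. \<integral>\<^sup>+\<omega>. ennreal ((h i \<omega>)\<^sup>2) \<partial>M) \<le> ennreal a" "0 < a"
    and w: "(\<Sum>i\<in>A. \<integral>\<^sup>+\<omega>. ennreal ((w i \<omega>)\<^sup>2) \<partial>M) \<le> ennreal b" "0 < b"
  shows "(\<Sum>i\<in>A. \<integral>\<^sup>+\<omega>. ennreal (h i \<omega> * w i \<omega>) \<partial>M) \<le> ennreal (sqrt (a * b))"
proof -
  define s where "s = sqrt b / sqrt a" \<comment> \<open>minimises \<open>s a / 2 + b / (2 s)\<close>\<close>
  have s: "s > 0" using h(2) w(2) by (simp add: s_def)
  have young: "p * q \<le> s / 2 * p\<^sup>2 + 1 / (2 * s) * q\<^sup>2" for p q :: real
  proof -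
    have "0 \<le> (s * p - q)\<^sup>2" by simp
    then show ?thesis using s by (simp add: power2_eq_square field_simps)
  qed
  have "(\<integral>\<^sup>+\<omega>. ennreal (h i \<omega> * w i \<omega>) \<partial>M)
      \<le> ennreal (s / 2) * (\<integral>\<^sup>+\<omega>. ennreal ((h i \<omega>)\<^sup>2) \<partial>M) + ennreal (1 / (2 * s)) * (\<integral>\<^sup>+\<omega>. ennreal ((w i \<omega>)\<^sup>2) \<partial>M)"
    if "i \<in> A" for i
  proof -
    note meas[OF that, measurable]
    have "(\<integral>\<^sup>+\<omega>. ennreal (h i \<omega> * w i \<omega>) \<partial>M)
        \<le> (\<integral>\<^sup>+\<omega>. ennreal (s / 2) * ennreal ((h i \<omega>)\<^sup>2) + ennreal (1 / (2 * s)) * ennreal ((w i \<omega>)\<^sup>2) \<partial>M)"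
      using s young
      by (intro nn_integral_mono) (auto simp: ennreal_mult[symmetric] ennreal_plus[symmetric] simp del: ennreal_plus intro!: ennreal_leI)
    then show ?thesis by (simp add: nn_integral_add nn_integral_cmult)
  qed
  then have "(\<Sum>i\<in>A. \<integral>\<^sup>+\<omega>. ennreal (h i \<omega> * w i \<omega>) \<partial>M)
      \<le> ennreal (s / 2) * (\<Sum>i\<in>A. \<integral>\<^sup>+\<omega>. ennreal ((h i \<omega>)\<^sup>2) \<partial>M)
        + ennreal (1 / (2 * s)) * (\<Sum>i\<in>A. \<integral>\<^sup>+\<omega>. ennreal ((w i \<omega>)\<^sup>2) \<partial>M)"
    unfolding sum_distrib_left sum.distrib[symmetric] by (intro sum_mono)
  also have "\<dots> \<le> ennreal (s / 2) * ennreal a + ennreal (1 / (2 * s)) * ennreal b"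
    by (intro add_mono mult_left_mono h w) auto
  also have "\<dots> = ennreal (s / 2 * a + 1 / (2 * s) * b)"
    using s h(2) w(2) by (simp add: ennreal_mult[symmetric] ennreal_plus[symmetric] del: ennreal_plus)
  also have "s / 2 * a + 1 / (2 * s) * b = sqrt (a * b)"
    using h(2) w(2) by (simp add: s_def real_sqrt_mult real_div_sqrt field_simps)
  finally show ?thesis .
qed

text \<open>Young's inequality weighted so that one factor 1 - \<alpha> survives as a contraction of
  \<open>p\<close> while the other pays for the cross term, at the price 1/\<alpha> on
  \<open>q\<close>. With b = 1 - \<alpha>, the difference of the sides times \<alpha> is \<open>b *
  (\<alpha> * p - b * q)\<^sup>2 + q\<^sup>2 * (1 - b\<^sup>2)\<close>.\<close>

lemma square_add_weighted_le:
  fixes \<alpha> p q :: real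
  assumes "0 < \<alpha>" "\<alpha> \<le> 1"
  shows "((1 - \<alpha>) * (p + q))\<^sup>2 \<le> (1 - \<alpha>) * p\<^sup>2 + q\<^sup>2 / \<alpha>"
proof -
  define b where "b = 1 - \<alpha>"
  have \<alpha>: "\<alpha> = 1 - b" by (simp add: b_def)
  have "b\<^sup>2 \<le> 1" using assms by (simp add: b_def power_le_one)
  then have "0 \<le> b * (\<alpha> * p - b * q)\<^sup>2 + q\<^sup>2 * (1 - b\<^sup>2)"
    using assms by (intro add_nonneg_nonneg mult_nonneg_nonneg) (auto simp: b_def)
  also have "\<dots> = \<alpha> * (b * p\<^sup>2) + q\<^sup>2 - \<alpha> * (b * (p + q))\<^sup>2"
    unfolding \<alpha> by (simp add: power2_eq_square algebra_simps)
  finally have "\<alpha> * (b * (p + q))\<^sup>2 \<le> \<alpha> * (b * p\<^sup>2 + q\<^sup>2 / \<alpha>)"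
    using assms by (simp add: distrib_left)
  then show ?thesis using assms by (simp add: b_def)
qed

text \<open>Each later term is at most \<open>m\<close> times an increment of the logarithm. The
  first term is bounded by 1 instead, so that no ln m, possibly very negative, enters the
  bound.\<close>

lemma sum_shifted_harmonic_le_ln:
  fixes m :: real
  assumes "m > 0" "T \<ge> 1"
  shows "(\<Sum>t = 1..T. m / (m + real t)) \<le> 1 + m * ln (m + real T)"
  using \<open>T \<ge> 1\<close>
proof (induction T rule: dec_induct)
  case base
  have "m / (m + 1) \<le> 1" "0 \<le> m * ln (m + 1)" using assms by simp_all
  then show ?case by simp
next
  case (step T)
  have "ln (m + real T) - ln (m + real (Suc T)) \<le> ((m + real T) - (m + real (Suc T))) / (m + real (Suc T))"
    using assms by (intro ln_diff_le) auto
  then have "1 / (m + real (Suc T)) \<le> ln (m + real (Suc T)) - ln (m + real T)" by simp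
  then have "m * (1 / (m + real (Suc T))) \<le> m * (ln (m + real (Suc T)) - ln (m + real T))"
    using assms by (intro mult_left_mono) auto
  with step.IH show ?case by (simp add: algebra_simps)
qed

lemma ennreal_sqrt_ennreal: "0 \<le> a \<Longrightarrow> ennreal_sqrt (ennreal a) = ennreal (sqrt a)"
  by (simp add: ennreal_sqrt_def)

text \<open>With fourth roots p of \<open>m\<close> and q of \<open>T\<close>, subadditivity of the
  root bounds the nested root by 1 + q/p. Of the divisor \<open>T\<close>, the fourth power of q,
  one half goes into \<open>sqrt (a / T)\<close>; the other turns 1 + q/p into the two rates 1/q^2
  and 1/(pq).\<close>

lemma sqrt_rate_le:
  fixes a M m \<rho> :: real
  assumes "0 < m" "0 < T" "0 < \<rho>" "0 \<le> a" "0 \<le> M"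
  shows "sqrt (a * (8 * M / \<rho>\<^sup>2 * (1 + sqrt (T / m)))) / T
    \<le> sqrt (a / T) / \<rho> * (2 * sqrt (2 * M) / sqrt T + 2 * sqrt (2 * M) / (m powr (1/4) * T powr (1/4)))"
proof -
  define p where "p = m powr (1/4)"
  define q where "q = T powr (1/4)"
  have p: "p > 0" "sqrt m = p\<^sup>2" and q: "q > 0" "sqrt T = q\<^sup>2"
    using assms by (simp_all add: p_def q_def power2_eq_square powr_add[symmetric] powr_half_sqrt)
  have T: "T = q\<^sup>2 * q\<^sup>2" using q(2) assms by (metis real_sqrt_mult_self abs_of_pos)
  have "sqrt (1 + sqrt (T / m)) \<le> 1 + sqrt (sqrt (T / m))"
    using sqrt_add_le_add_sqrt[of 1 "sqrt (T / m)"] assms by simp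
  also have "sqrt (sqrt (T / m)) = q / p"
    using p q by (simp add: real_sqrt_divide)
  finally have root: "sqrt (1 + sqrt (T / m)) \<le> 1 + q / p" .
  have "sqrt 8 = 2 * sqrt 2"
    using real_sqrt_mult[of 4 2] by simp
  then have "sqrt (a * (8 * M / \<rho>\<^sup>2 * (1 + sqrt (T / m)))) / T
      = sqrt a * (2 * sqrt (2 * M) / \<rho>) / T * sqrt (1 + sqrt (T / m))"
    using assms by (simp add: real_sqrt_mult real_sqrt_divide)
  also have "\<dots> \<le> sqrt a * (2 * sqrt (2 * M) / \<rho>) / T * (1 + q / p)"
    using assms root by (intro mult_left_mono) auto
  also have "\<dots> = sqrt (a / T) / \<rho> * (2 * sqrt (2 * M) / sqrt T + 2 * sqrt (2 * M) / (p * q))"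
    using assms(3) p q T by (simp add: real_sqrt_divide field_simps power2_eq_square)
  finally show ?thesis by (simp add: p_def q_def)
qed

subsection \<open>Adaptedness of the iterates\<close>

text \<open>The schedule \<mu>, \<alpha> stays general here. The estimates below rest on a step-size
  condition linking \<mu> and \<alpha>, and the concrete schedule enters only in the final
  theorem.\<close>

locale super_adam_zero = super_adam M D F UNIV 0 \<gamma> \<mu> \<alpha> x1 \<xi> H xt x g
  for M :: "'w measure" and D :: "'s measure" and F :: "real ^ 'd \<Rightarrow> 's \<Rightarrow> real"
    and \<gamma> :: real and \<mu> \<alpha> :: "nat \<Rightarrow> real" and x1 :: "real ^ 'd"
    and \<xi> :: "nat \<Rightarrow> 'w \<Rightarrow> 's" and H :: "nat \<Rightarrow> 'w \<Rightarrow> real ^ 'd ^ 'd"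
    and xt x g :: "nat \<Rightarrow> 'w \<Rightarrow> real ^ 'd" +
  fixes f :: "real ^ 'd \<Rightarrow> real" and \<sigma> \<rho> L :: real
  assumes objective: "\<And>y. has_bochner_integral D (F y) (f y)"
    and F_differentiable: "\<And>s y. s \<in> space D \<Longrightarrow> (\<lambda>z. F z s) differentiable (at y)"
    and f_differentiable: "\<And>y. f differentiable (at y)"
    and unbiased: "\<And>y. has_bochner_integral D (\<lambda>s. gradient (\<lambda>z. F z s) y) (gradient f y)"
    and variance:
      "\<And>y. (\<integral>\<^sup>+s. ennreal ((norm (gradient (\<lambda>z. F z s) y - gradient f y))\<^sup>2) \<partial>D) \<le> ennreal (\<sigma>\<^sup>2)"
    and bounded_below: "bdd_below (range f)"
    and rho: "\<rho> > 0"
    and H_lower: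
      "\<And>t \<omega>. t \<ge> 1 \<Longrightarrow> \<omega> \<in> space M \<Longrightarrow> pos_semidef (H t \<omega> - \<rho> *\<^sub>R mat 1)"
    and L: "L > 0"
    and smooth: "\<And>y z. norm (gradient f y - gradient f z) \<le> L * norm (y - z)"
begin

definition history :: "nat \<Rightarrow> 'w \<Rightarrow> nat \<Rightarrow> 's" where
  "history t \<omega> = (\<lambda>i\<in>{1..t}. \<xi> i \<omega>)"

definition history_space :: "nat \<Rightarrow> (nat \<Rightarrow> 's) measure" where
  "history_space t = Pi\<^sub>M {1..t} (\<lambda>_. D)"

definition err :: "nat \<Rightarrow> 'w \<Rightarrow> real ^ 'd" where
  "err t \<omega> = gradient f (x t \<omega>) - g t \<omega>"

definition dir :: "nat \<Rightarrow> 'w \<Rightarrow> real ^ 'd" where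
  "dir t \<omega> = xt (t + 1) \<omega> - x t \<omega>"

lemma sample_measurable [measurable]: "t \<ge> 1 \<Longrightarrow> \<xi> t \<in> M \<rightarrow>\<^sub>M D"
  using samples_indep by (auto simp: indep_vars_def)

lemma prob_space_D: "prob_space D"
  using prob_space_distr[OF sample_measurable[of 1]] samples_law[of 1] by simp

lemma gradient_F_measurable [measurable]:
  "(\<lambda>p. gradient (\<lambda>z. F z (snd p)) (fst p)) \<in> borel_measurable (borel \<Otimes>\<^sub>M D)"
  by (rule borel_measurable_gradient_pair)
     (use objective F_differentiable in \<open>auto simp: has_bochner_integral_iff\<close>)

lemma gradient_F_compose_measurable:
  assumes "a \<in> borel_measurable N" "b \<in> N \<rightarrow>\<^sub>M D"
  shows "(\<lambda>p. gradient (\<lambda>z. F z (b p)) (a p)) \<in> borel_measurable N"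
  using measurable_compose[OF measurable_Pair[OF assms] gradient_F_measurable] by simp

lemma gradient_f_measurable [measurable]: "gradient f \<in> borel_measurable borel"
proof (rule borel_measurable_continuous_onI)
  have "L-lipschitz_on UNIV (gradient f)"
    using smooth L by (auto simp: lipschitz_on_def dist_norm)
  then show "continuous_on UNIV (gradient f)" by (rule lipschitz_on_continuous_on)
qed

lemma history_measurable: "history t \<in> M \<rightarrow>\<^sub>M history_space t"
  unfolding history_def[abs_def] history_space_def by (intro measurable_restrict) auto

lemma history_truncate_measurable:
  "s \<le> t \<Longrightarrow> (\<lambda>p. restrict p {1..s}) \<in> history_space t \<rightarrow>\<^sub>M history_space s"
  unfolding history_space_def by (intro measurable_restrict_subset) auto

lemma sample_coordinate_measurable: "t \<ge> 1 \<Longrightarrow> (\<lambda>p. p t) \<in> history_space t \<rightarrow>\<^sub>M D"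
  unfolding history_space_def by (intro measurable_component_singleton) auto

lemma history_truncate: "restrict (history (Suc t) \<omega>) {1..t} = history t \<omega>"
  by (auto simp: history_def restrict_def fun_eq_iff)

lemma newton_step:
  assumes "t \<ge> 1" "\<omega> \<in> space M"
  shows "H t \<omega> *v dir t \<omega> = - \<gamma> *\<^sub>R g t \<omega>"
  unfolding dir_def using is_arg_min_quadratic_model[OF xt_step[OF assms] H_symmetric[OF assms] gamma] .

lemma H_coercive:
  assumes "t \<ge> 1" "\<omega> \<in> space M"
  shows "\<rho> * (norm v)\<^sup>2 \<le> v \<bullet> (H t \<omega> *v v)"
  using pos_semidef_diff_scaleR_mat[OF H_lower[OF assms]] .

lemma det_H_nonzero:
  assumes "t \<ge> 1" "\<omega> \<in> space M"
  shows "det (H t \<omega>) \<noteq> 0"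
proof -
  have "v = 0" if "H t \<omega> *v v = 0" for v
    using H_coercive[OF assms, of v] rho that by (simp add: mult_le_0_iff)
  then show ?thesis
    by (metis invertible_det_nz invertible_left_inverse matrix_left_invertible_ker)
qed

lemma dir_cramer:
  assumes "t \<ge> 1" "\<omega> \<in> space M"
  shows "dir t \<omega> = (\<chi> k. det (\<chi> i j. if j = k then (- \<gamma> *\<^sub>R g t \<omega>) $ i else H t \<omega> $ i $ j) / det (H t \<omega>))"
  using cramer[OF det_H_nonzero[OF assms]] newton_step[OF assms] by blast

text \<open>Measurability with respect to the past is encoded as factorisation through the vector of
  samples, not through a filtration, so that product measures and Tonelli apply directly.\<close>

definition adapted :: "nat \<Rightarrow> ('w \<Rightarrow> 'b::topological_space) \<Rightarrow> bool" where
  "adapted t X \<longleftrightarrow> (\<exists>X'\<in>borel_measurable (history_space t). \<forall>\<omega>\<in>space M. X \<omega> = X' (history t \<omega>))"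

lemma adaptedE:
  assumes "adapted t X"
  obtains X' where "X' \<in> borel_measurable (history_space t)" "\<And>\<omega>. \<omega> \<in> space M \<Longrightarrow> X \<omega> = X' (history t \<omega>)"
  using assms unfolding adapted_def by blast

lemma adaptedI:
  assumes "X' \<in> borel_measurable (history_space t)" "\<And>\<omega>. \<omega> \<in> space M \<Longrightarrow> X \<omega> = X' (history t \<omega>)"
  shows "adapted t X"
  using assms unfolding adapted_def by blast

lemma adapted_measurable:
  assumes "adapted t X"
  shows "X \<in> borel_measurable M"
proof -
  obtain X' where X': "X' \<in> borel_measurable (history_space t)"
      "\<And>\<omega>. \<omega> \<in> space M \<Longrightarrow> X \<omega> = X' (history t \<omega>)"
    using assms by (rule adaptedE) blast
  have "(\<lambda>\<omega>. X' (history t \<omega>)) \<in> borel_measurable M"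
    by (rule measurable_compose[OF history_measurable X'(1)])
  then show ?thesis using X'(2) by (simp cong: measurable_cong)
qed

lemma adapted_H: "t \<ge> 1 \<Longrightarrow> adapted t (H t)"
  using H_rule[of t] unfolding adapted_def history_space_def history_def by blast

lemma adapted_Suc:
  assumes "adapted t X"
  shows "adapted (Suc t) X"
proof -
  obtain X' where X': "X' \<in> borel_measurable (history_space t)"
      "\<And>\<omega>. \<omega> \<in> space M \<Longrightarrow> X \<omega> = X' (history t \<omega>)"
    using assms by (rule adaptedE) blast
  have "(\<lambda>p. X' (restrict p {1..t})) \<in> borel_measurable (history_space (Suc t))"
    by (rule measurable_compose[OF history_truncate_measurable X'(1)]) simp
  then show ?thesis by (rule adaptedI) (simp only: X'(2) history_truncate)
qed

lemma adapted_dir: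
  assumes "t \<ge> 1" "adapted t (g t)"
  shows "adapted t (dir t)"
proof -
  obtain H' where H': "H' \<in> borel_measurable (history_space t)"
      "\<And>\<omega>. \<omega> \<in> space M \<Longrightarrow> H t \<omega> = H' (history t \<omega>)"
    using adapted_H[OF assms(1)] by (rule adaptedE) blast
  obtain g' where g': "g' \<in> borel_measurable (history_space t)"
      "\<And>\<omega>. \<omega> \<in> space M \<Longrightarrow> g t \<omega> = g' (history t \<omega>)"
    using assms(2) by (rule adaptedE) blast
  show ?thesis
  proof (rule adaptedI)
    show "(\<lambda>p. \<chi> k. det (\<chi> i j. if j = k then (- \<gamma> *\<^sub>R g' p) $ i else H' p $ i $ j) / det (H' p))
        \<in> borel_measurable (history_space t)"
      using H'(1) g'(1) by (intro borel_measurable_cramer) auto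
  qed (simp only: dir_cramer[OF assms(1)] H'(2) g'(2))
qed

lemma x_Suc: "t \<ge> 1 \<Longrightarrow> \<omega> \<in> space M \<Longrightarrow> x (Suc t) \<omega> = x t \<omega> + \<mu> t *\<^sub>R dir t \<omega>"
  using x_step[of t \<omega>] by (simp add: dir_def algebra_simps)

lemma g_Suc: "t \<ge> 1 \<Longrightarrow> \<omega> \<in> space M \<Longrightarrow>
    g (Suc t) \<omega> = \<alpha> (Suc t) *\<^sub>R gradient (\<lambda>y. F y (\<xi> (Suc t) \<omega>)) (x (Suc t) \<omega>)
      + (1 - \<alpha> (Suc t)) *\<^sub>R g t \<omega>"
  using g_step[of t \<omega>] by simp

text \<open>The index stays at \<open>t\<close>: the next iterate is fixed before
  \<open>\<xi> (Suc t)\<close> is drawn. This is what makes the fresh gradient noise centred given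
  the past.\<close>

lemma adapted_x_Suc:
  assumes "t \<ge> 1" "adapted t (x t)" "adapted t (g t)"
  shows "adapted t (x (Suc t))"
proof -
  obtain x' where x': "x' \<in> borel_measurable (history_space t)"
      "\<And>\<omega>. \<omega> \<in> space M \<Longrightarrow> x t \<omega> = x' (history t \<omega>)"
    using assms(2) by (rule adaptedE) blast
  obtain d' where d': "d' \<in> borel_measurable (history_space t)"
      "\<And>\<omega>. \<omega> \<in> space M \<Longrightarrow> dir t \<omega> = d' (history t \<omega>)"
    using adapted_dir[OF assms(1,3)] by (rule adaptedE) blast
  show ?thesis
    by (rule adaptedI[where X' = "\<lambda>p. x' p + \<mu> t *\<^sub>R d' p"])
       (use x' d' assms(1) in \<open>auto simp: x_Suc\<close>)
qed

lemma adapted_x_g: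
  assumes "t \<ge> 1"
  shows "adapted t (x t) \<and> adapted t (g t)"
  using assms
proof (induction t rule: dec_induct)
  case base
  have "adapted 1 (x 1)"
    by (rule adaptedI[where X' = "\<lambda>_. x1"]) (auto simp: x_start simp del: One_nat_def)
  moreover have "adapted 1 (g 1)"
  proof (rule adaptedI)
    show "(\<lambda>p. gradient (\<lambda>y. F y (p 1)) x1) \<in> borel_measurable (history_space 1)"
      by (intro gradient_F_compose_measurable sample_coordinate_measurable) auto
  qed (simp add: g_start x_start history_def del: One_nat_def)
  ultimately show ?case by simp
next
  case (step t)
  then have "adapted t (x (Suc t))" by (intro adapted_x_Suc) auto
  then have x: "adapted (Suc t) (x (Suc t))" by (rule adapted_Suc)
  then obtain x' where x': "x' \<in> borel_measurable (history_space (Suc t))"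
      "\<And>\<omega>. \<omega> \<in> space M \<Longrightarrow> x (Suc t) \<omega> = x' (history (Suc t) \<omega>)"
    by (rule adaptedE) blast
  obtain g' where g': "g' \<in> borel_measurable (history_space (Suc t))"
      "\<And>\<omega>. \<omega> \<in> space M \<Longrightarrow> g t \<omega> = g' (history (Suc t) \<omega>)"
    using adapted_Suc step.IH by (metis adaptedE)
  have "adapted (Suc t) (g (Suc t))"
  proof (rule adaptedI)
    have "(\<lambda>p. gradient (\<lambda>y. F y (p (Suc t))) (x' p)) \<in> borel_measurable (history_space (Suc t))"
      by (intro gradient_F_compose_measurable sample_coordinate_measurable x') auto
    then show "(\<lambda>p. \<alpha> (Suc t) *\<^sub>R gradient (\<lambda>y. F y (p (Suc t))) (x' p) + (1 - \<alpha> (Suc t)) *\<^sub>R g' p)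
        \<in> borel_measurable (history_space (Suc t))"
      using g'(1) by measurable
    fix \<omega> assume "\<omega> \<in> space M"
    then show "g (Suc t) \<omega> = \<alpha> (Suc t) *\<^sub>R gradient (\<lambda>y. F y (history (Suc t) \<omega> (Suc t))) (x' (history (Suc t) \<omega>))
        + (1 - \<alpha> (Suc t)) *\<^sub>R g' (history (Suc t) \<omega>)"
      using step.hyps x'(2) g'(2) by (simp add: g_Suc history_def)
  qed
  with x show ?case by simp
qed

lemma
  assumes "t \<ge> 1"
  shows x_measurable [measurable]: "x t \<in> borel_measurable M"
    and g_measurable [measurable]: "g t \<in> borel_measurable M"
    and dir_measurable [measurable]: "dir t \<in> borel_measurable M"
    and err_measurable [measurable]: "err t \<in> borel_measurable M"
    and H_measurable [measurable]: "H t \<in> borel_measurable M"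
proof -
  show m [measurable]: "x t \<in> borel_measurable M" "g t \<in> borel_measurable M"
      "dir t \<in> borel_measurable M" "H t \<in> borel_measurable M"
    using adapted_x_g[OF assms] adapted_dir[OF assms] adapted_H[OF assms] adapted_measurable by auto
  show "err t \<in> borel_measurable M" unfolding err_def[abs_def] by measurable
qed

text \<open>Takes the place of conditional expectation given the past. History and fresh sample are
  independent, so their joint law is a product and Tonelli integrates the sample out with the
  history frozen.\<close>

lemma nn_integral_history_sample:
  assumes \<psi>: "\<psi> \<in> borel_measurable (history_space t \<Otimes>\<^sub>M D)"
  shows "(\<integral>\<^sup>+\<omega>. \<psi> (history t \<omega>, \<xi> (Suc t) \<omega>) \<partial>M) = (\<integral>\<^sup>+\<omega>. (\<integral>\<^sup>+s. \<psi> (history t \<omega>, s) \<partial>D) \<partial>M)"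
proof -
  interpret D: prob_space D by (rule prob_space_D)
  \<comment> \<open>Independence is available for blocks of indices, so the fresh sample is first
    viewed as a family over the one-point block \<open>{Suc t}\<close>.\<close>
  define S where "S = Pi\<^sub>M {Suc t} (\<lambda>_. D)"
  define \<eta> where "\<eta> \<omega> = (\<lambda>i\<in>{Suc t}. \<xi> i \<omega>)" for \<omega>
  have \<eta>_last: "\<eta> \<omega> (Suc t) = \<xi> (Suc t) \<omega>" for \<omega> by (simp add: \<eta>_def)
  have \<eta> [measurable]: "\<eta> \<in> M \<rightarrow>\<^sub>M S"
    unfolding \<eta>_def[abs_def] S_def by (intro measurable_restrict) auto
  have last [measurable]: "(\<lambda>q. q (Suc t)) \<in> S \<rightarrow>\<^sub>M D"
    unfolding S_def by (intro measurable_component_singleton) auto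
  note history_measurable[measurable] \<psi>[measurable]
  interpret S: prob_space "distr M S \<eta>" by (rule prob_space_distr) simp
  have indep: "distr M (history_space t) (history t) \<Otimes>\<^sub>M distr M S \<eta>
      = distr M (history_space t \<Otimes>\<^sub>M S) (\<lambda>\<omega>. (history t \<omega>, \<eta> \<omega>))"
    using indep_var_restrict[OF samples_indep, of "{1..t}" "{Suc t}"]
    by (simp add: indep_var_distribution_eq history_space_def history_def[abs_def] S_def \<eta>_def[abs_def])
  have inner: "(\<integral>\<^sup>+q. \<psi> (p, q (Suc t)) \<partial>distr M S \<eta>) = (\<integral>\<^sup>+s. \<psi> (p, s) \<partial>D)"
    if [simp]: "p \<in> space (history_space t)" for p
  proof -
    have "(\<integral>\<^sup>+q. \<psi> (p, q (Suc t)) \<partial>distr M S \<eta>) = (\<integral>\<^sup>+\<omega>. \<psi> (p, \<xi> (Suc t) \<omega>) \<partial>M)"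
      by (subst nn_integral_distr) (auto simp: \<eta>_last)
    also have "\<dots> = (\<integral>\<^sup>+s. \<psi> (p, s) \<partial>distr M D (\<xi> (Suc t)))"
      by (subst nn_integral_distr) auto
    finally show ?thesis using samples_law[of "Suc t"] by simp
  qed
  have "(\<integral>\<^sup>+\<omega>. \<psi> (history t \<omega>, \<xi> (Suc t) \<omega>) \<partial>M)
      = (\<integral>\<^sup>+pq. \<psi> (fst pq, snd pq (Suc t)) \<partial>distr M (history_space t \<Otimes>\<^sub>M S) (\<lambda>\<omega>. (history t \<omega>, \<eta> \<omega>)))"
    by (subst nn_integral_distr) (auto simp: \<eta>_last)
  also have "\<dots> = (\<integral>\<^sup>+p. (\<integral>\<^sup>+q. \<psi> (p, q (Suc t)) \<partial>distr M S \<eta>) \<partial>distr M (history_space t) (history t))"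
    unfolding indep[symmetric] by (subst S.nn_integral_fst[symmetric]) auto
  also have "\<dots> = (\<integral>\<^sup>+p. (\<integral>\<^sup>+s. \<psi> (p, s) \<partial>D) \<partial>distr M (history_space t) (history t))"
    by (intro nn_integral_cong inner) simp
  also have "\<dots> = (\<integral>\<^sup>+\<omega>. (\<integral>\<^sup>+s. \<psi> (history t \<omega>, s) \<partial>D) \<partial>M)"
    by (rule nn_integral_distr) (auto intro: D.borel_measurable_nn_integral_fst)
  finally show ?thesis .
qed

subsection \<open>The potential\<close>

definition gap :: "nat \<Rightarrow> 'w \<Rightarrow> real" where
  "gap t \<omega> = f (x t \<omega>) - (INF y. f y)"

text \<open>The part of \<open>err (Suc t)\<close> determined before the fresh sample is drawn; the
  remainder is \<open>\<alpha> (Suc t)\<close> times the gradient noise.\<close>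

definition drift :: "nat \<Rightarrow> 'w \<Rightarrow> real ^ 'd" where
  "drift t \<omega> = (1 - \<alpha> (Suc t)) *\<^sub>R (gradient f (x (Suc t) \<omega>) - g t \<omega>)"

text \<open>The reciprocal weights are those of Young's inequality for the product of error and
  direction in the descent estimate.\<close>

definition progress :: "nat \<Rightarrow> 'w \<Rightarrow> real" where
  "progress t \<omega> = \<gamma> / \<rho> * (norm (err t \<omega>))\<^sup>2 + \<rho> / \<gamma> * (norm (dir t \<omega>))\<^sup>2"

definition potential :: "nat \<Rightarrow> ennreal" where
  "potential t = (\<integral>\<^sup>+\<omega>. ennreal (gap t \<omega>) \<partial>M) + ennreal (1 / L) * (\<integral>\<^sup>+\<omega>. ennreal ((norm (err t \<omega>))\<^sup>2) \<partial>M)"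

lemma gap_nonneg: "0 \<le> gap t \<omega>"
  unfolding gap_def using cINF_lower[OF bounded_below, of "x t \<omega>"] by simp

lemma progress_nonneg: "0 \<le> progress t \<omega>"
  unfolding progress_def using gamma rho by simp

lemma f_measurable [measurable]: "f \<in> borel_measurable borel"
  using f_differentiable
  by (intro borel_measurable_continuous_onI differentiable_imp_continuous_on) (auto simp: differentiable_on_def)

lemma
  assumes "t \<ge> 1"
  shows gap_measurable [measurable]: "gap t \<in> borel_measurable M"
    and drift_measurable [measurable]: "drift t \<in> borel_measurable M"
    and progress_measurable [measurable]: "progress t \<in> borel_measurable M"
    and spectral_norm_H_measurable [measurable]: "(\<lambda>\<omega>. spectral_norm (H t \<omega>)) \<in> borel_measurable M"
proof -
  have [measurable]: "x t \<in> borel_measurable M" "x (Suc t) \<in> borel_measurable M" "g t \<in> borel_measurable M"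
      "dir t \<in> borel_measurable M" "err t \<in> borel_measurable M" "H t \<in> borel_measurable M"
    using assms by simp_all
  have [measurable]: "(spectral_norm :: real ^ 'd ^ 'd \<Rightarrow> real) \<in> borel_measurable borel"
    by (rule borel_measurable_continuous_onI[OF continuous_on_spectral_norm])
  show "gap t \<in> borel_measurable M" unfolding gap_def[abs_def] by measurable
  show "drift t \<in> borel_measurable M" unfolding drift_def[abs_def] by measurable
  show "progress t \<in> borel_measurable M" unfolding progress_def[abs_def] by measurable
  show "(\<lambda>\<omega>. spectral_norm (H t \<omega>)) \<in> borel_measurable M" by measurable
qed

lemma nn_integral_noise:
  "(\<integral>\<^sup>+s. ennreal ((norm (a + r *\<^sub>R (gradient f y - gradient (\<lambda>z. F z s) y)))\<^sup>2) \<partial>D)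
    \<le> ennreal ((norm a)\<^sup>2 + r\<^sup>2 * \<sigma>\<^sup>2)"
proof -
  interpret D: prob_space D by (rule prob_space_D)
  have "integrable D (\<lambda>s. gradient (\<lambda>z. F z s) y)" "D.expectation (\<lambda>s. gradient (\<lambda>z. F z s) y) = gradient f y"
    using unbiased[of y] by (auto simp: has_bochner_integral_iff)
  moreover have "(\<integral>\<^sup>+s. ennreal ((norm (gradient f y - gradient (\<lambda>z. F z s) y))\<^sup>2) \<partial>D) \<le> ennreal (\<sigma>\<^sup>2)"
    using variance[of y] by (simp add: norm_minus_commute)
  ultimately show ?thesis
    by (intro D.nn_integral_norm_add_scaleR_noise) (auto simp: D.prob_space)
qed

text \<open>The initial estimator is a single sampled gradient at a deterministic point, so the
  first error is pure noise.\<close>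

lemma nn_integral_err_1: "(\<integral>\<^sup>+\<omega>. ennreal ((norm (err 1 \<omega>))\<^sup>2) \<partial>M) \<le> ennreal (\<sigma>\<^sup>2)"
proof -
  have [measurable]: "(\<lambda>s. gradient (\<lambda>z. F z s) x1) \<in> borel_measurable D"
    using unbiased[of x1] by (auto simp: has_bochner_integral_iff)
  have "(\<integral>\<^sup>+\<omega>. ennreal ((norm (err 1 \<omega>))\<^sup>2) \<partial>M)
      = (\<integral>\<^sup>+\<omega>. ennreal ((norm (gradient f x1 - gradient (\<lambda>z. F z (\<xi> 1 \<omega>)) x1))\<^sup>2) \<partial>M)"
    by (intro nn_integral_cong) (simp add: err_def g_start x_start del: One_nat_def)
  also have "\<dots> = (\<integral>\<^sup>+s. ennreal ((norm (gradient f x1 - gradient (\<lambda>z. F z s) x1))\<^sup>2) \<partial>distr M D (\<xi> 1))"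
    by (subst nn_integral_distr) auto
  also have "\<dots> \<le> ennreal (\<sigma>\<^sup>2)"
    using nn_integral_noise[of 0 1 x1] samples_law[of 1] by simp
  finally show ?thesis .
qed

text \<open>The new error is \<open>drift t\<close> plus scaled gradient noise. The drift and the
  point where the noise is evaluated are functions of the history, so integrating the fresh sample
  first removes the cross term.\<close>

lemma nn_integral_err_Suc:
  assumes t: "t \<ge> 1"
  shows "(\<integral>\<^sup>+\<omega>. ennreal ((norm (err (Suc t) \<omega>))\<^sup>2) \<partial>M)
    \<le> (\<integral>\<^sup>+\<omega>. ennreal ((norm (drift t \<omega>))\<^sup>2) \<partial>M) + ennreal ((\<alpha> (Suc t))\<^sup>2 * \<sigma>\<^sup>2)"
proof -
  let ?a = "\<alpha> (Suc t)"
  have ad: "adapted t (x t)" "adapted t (g t)" using adapted_x_g[OF t] by auto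
  obtain x' where x': "x' \<in> borel_measurable (history_space t)"
      "\<And>\<omega>. \<omega> \<in> space M \<Longrightarrow> x (Suc t) \<omega> = x' (history t \<omega>)"
    using adapted_x_Suc[OF t ad] by (rule adaptedE) blast
  obtain g' where g': "g' \<in> borel_measurable (history_space t)"
      "\<And>\<omega>. \<omega> \<in> space M \<Longrightarrow> g t \<omega> = g' (history t \<omega>)"
    using ad(2) by (rule adaptedE) blast
  note x'(1) [measurable] g'(1) [measurable]
  define \<psi> where "\<psi> q = ennreal ((norm ((1 - ?a) *\<^sub>R (gradient f (x' (fst q)) - g' (fst q))
      + ?a *\<^sub>R (gradient f (x' (fst q)) - gradient (\<lambda>z. F z (snd q)) (x' (fst q)))))\<^sup>2)" for q
  have [measurable]: "(\<lambda>q. gradient (\<lambda>z. F z (snd q)) (x' (fst q))) \<in> borel_measurable (history_space t \<Otimes>\<^sub>M D)"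
    by (rule gradient_F_compose_measurable) measurable
  have \<psi>: "\<psi> \<in> borel_measurable (history_space t \<Otimes>\<^sub>M D)"
    unfolding \<psi>_def[abs_def] by measurable
  have "(\<integral>\<^sup>+\<omega>. ennreal ((norm (err (Suc t) \<omega>))\<^sup>2) \<partial>M) = (\<integral>\<^sup>+\<omega>. \<psi> (history t \<omega>, \<xi> (Suc t) \<omega>) \<partial>M)"
  proof (intro nn_integral_cong)
    fix \<omega> assume "\<omega> \<in> space M"
    then have "err (Suc t) \<omega> = (1 - ?a) *\<^sub>R (gradient f (x' (history t \<omega>)) - g' (history t \<omega>))
        + ?a *\<^sub>R (gradient f (x' (history t \<omega>)) - gradient (\<lambda>z. F z (\<xi> (Suc t) \<omega>)) (x' (history t \<omega>)))"
      using t by (simp add: err_def g_Suc x' g' algebra_simps)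
    then show "ennreal ((norm (err (Suc t) \<omega>))\<^sup>2) = \<psi> (history t \<omega>, \<xi> (Suc t) \<omega>)"
      by (simp add: \<psi>_def)
  qed
  also have "\<dots> = (\<integral>\<^sup>+\<omega>. (\<integral>\<^sup>+s. \<psi> (history t \<omega>, s) \<partial>D) \<partial>M)"
    by (rule nn_integral_history_sample[OF \<psi>])
  also have "\<dots> \<le> (\<integral>\<^sup>+\<omega>. ennreal ((norm (drift t \<omega>))\<^sup>2 + ?a\<^sup>2 * \<sigma>\<^sup>2) \<partial>M)"
  proof (intro nn_integral_mono)
    fix \<omega> assume "\<omega> \<in> space M"
    then have "drift t \<omega> = (1 - ?a) *\<^sub>R (gradient f (x' (history t \<omega>)) - g' (history t \<omega>))"
      by (simp add: drift_def x' g')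
    then show "(\<integral>\<^sup>+s. \<psi> (history t \<omega>, s) \<partial>D) \<le> ennreal ((norm (drift t \<omega>))\<^sup>2 + ?a\<^sup>2 * \<sigma>\<^sup>2)"
      using nn_integral_noise[of "drift t \<omega>" ?a "x' (history t \<omega>)"] by (simp add: \<psi>_def)
  qed
  also have "\<dots> = (\<integral>\<^sup>+\<omega>. ennreal ((norm (drift t \<omega>))\<^sup>2) \<partial>M) + ennreal (?a\<^sup>2 * \<sigma>\<^sup>2)"
    using t by (simp add: nn_integral_add emeasure_space_1)
  finally show ?thesis .
qed

section \<open>Pathwise estimates for one step\<close>

lemma alpha_Suc: "t \<ge> 1 \<Longrightarrow> 0 < \<alpha> (Suc t)" "t \<ge> 1 \<Longrightarrow> \<alpha> (Suc t) \<le> 1"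
  using alpha[of t] by auto

text \<open>Moving the evaluation point to the next iterate changes the gradient by at most
  \<open>L * \<mu> t * norm (dir t \<omega>)\<close>; the weighted square inequality then keeps a
  contraction of the old error.\<close>

lemma norm_drift_le:
  assumes t: "t \<ge> 1" and \<omega>: "\<omega> \<in> space M"
  shows "(norm (drift t \<omega>))\<^sup>2
    \<le> (1 - \<alpha> (Suc t)) * (norm (err t \<omega>))\<^sup>2 + (L * \<mu> t * norm (dir t \<omega>))\<^sup>2 / \<alpha> (Suc t)"
proof -
  have \<mu>: "\<mu> t > 0" using mu[OF t] by simp
  have "norm (gradient f (x (Suc t) \<omega>) - g t \<omega>)
      = norm (err t \<omega> + (gradient f (x (Suc t) \<omega>) - gradient f (x t \<omega>)))"
    by (simp add: err_def)
  also have "\<dots> \<le> norm (err t \<omega>) + L * norm (x (Suc t) \<omega> - x t \<omega>)"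
    by (intro norm_triangle_mono smooth) simp
  also have "\<dots> = norm (err t \<omega>) + L * \<mu> t * norm (dir t \<omega>)"
    using \<mu> by (simp add: x_Suc[OF t \<omega>])
  finally have "norm (drift t \<omega>) \<le> (1 - \<alpha> (Suc t)) * (norm (err t \<omega>) + L * \<mu> t * norm (dir t \<omega>))"
    using alpha_Suc[OF t] by (simp add: drift_def mult_left_mono)
  then have "(norm (drift t \<omega>))\<^sup>2 \<le> ((1 - \<alpha> (Suc t)) * (norm (err t \<omega>) + L * \<mu> t * norm (dir t \<omega>)))\<^sup>2"
    by (intro power_mono) auto
  also have "\<dots> \<le> (1 - \<alpha> (Suc t)) * (norm (err t \<omega>))\<^sup>2 + (L * \<mu> t * norm (dir t \<omega>))\<^sup>2 / \<alpha> (Suc t)"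
    by (rule square_add_weighted_le) (use alpha_Suc[OF t] in auto)
  finally show ?thesis .
qed

text \<open>Coercivity of \<open>H t\<close> tested on the direction itself, which
  \<open>H t\<close> maps to \<open>- \<gamma> *\<^sub>R g t \<omega>\<close>.\<close>

lemma dir_inner_g_le:
  assumes t: "t \<ge> 1" and \<omega>: "\<omega> \<in> space M"
  shows "dir t \<omega> \<bullet> g t \<omega> \<le> - (\<rho> / \<gamma>) * (norm (dir t \<omega>))\<^sup>2"
  using H_coercive[OF assms, of "dir t \<omega>"] gamma by (simp add: newton_step[OF assms] field_simps)

text \<open>Write r = \<rho>/\<gamma> and measure in units of \<open>\<mu> t * r\<close> times the
  squared direction. The estimator part gains 1, Young's inequality on error times direction costs
  1/4, and curvature costs 1/16 because \<open>8 * L * \<mu> t \<le> r\<close>. This leaves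
  11/16.\<close>

lemma descent:
  assumes t: "t \<ge> 1" and \<omega>: "\<omega> \<in> space M" and step: "8 * L * \<gamma> * \<mu> t \<le> \<rho>"
  shows "f (x (Suc t) \<omega>) \<le> f (x t \<omega>) + \<mu> t * (\<gamma> / \<rho> * (norm (err t \<omega>))\<^sup>2)
    - \<mu> t * (11/16 * (\<rho> / \<gamma> * (norm (dir t \<omega>))\<^sup>2))"
proof -
  define r where "r = \<rho> / \<gamma>"
  define e where "e = norm (err t \<omega>)"
  define d where "d = norm (dir t \<omega>)"
  have r: "r > 0" using rho gamma by (simp add: r_def)
  have \<mu>: "\<mu> t > 0" using mu[OF t] by simp
  have step': "8 * L * \<mu> t \<le> r" using step gamma by (simp add: r_def field_simps)
  have "f (x (Suc t) \<omega>) \<le> f (x t \<omega>) + gradient f (x t \<omega>) \<bullet> (\<mu> t *\<^sub>R dir t \<omega>) + L / 2 * (norm (\<mu> t *\<^sub>R dir t \<omega>))\<^sup>2"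
    unfolding x_Suc[OF t \<omega>] by (rule lipschitz_gradient_upper_bound[OF f_differentiable smooth])
  also have "\<dots> = f (x t \<omega>) + \<mu> t * (dir t \<omega> \<bullet> g t \<omega> + err t \<omega> \<bullet> dir t \<omega> + 1/16 * (8 * L * \<mu> t) * d\<^sup>2)"
    using \<mu> by (simp add: err_def d_def inner_simps inner_commute power2_eq_square algebra_simps)
  also have "\<dots> \<le> f (x t \<omega>) + \<mu> t * (- r * d\<^sup>2 + (1 / r * e\<^sup>2 + 1/4 * (r * d\<^sup>2)) + 1/16 * r * d\<^sup>2)"
  proof -
    have "err t \<omega> \<bullet> dir t \<omega> \<le> e * d" unfolding e_def d_def by (rule norm_cauchy_schwarz)
    also have "e * d \<le> 1 / r * e\<^sup>2 + 1/4 * (r * d\<^sup>2)"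
    proof -
      have "0 \<le> (e - r * d / 2)\<^sup>2" by simp
      then show ?thesis using r by (simp add: field_simps power2_eq_square)
    qed
    finally have "err t \<omega> \<bullet> dir t \<omega> \<le> 1 / r * e\<^sup>2 + 1/4 * (r * d\<^sup>2)" .
    moreover have "1/16 * (8 * L * \<mu> t) * d\<^sup>2 \<le> 1/16 * r * d\<^sup>2"
      using step' by (intro mult_right_mono mult_left_mono) auto
    ultimately show ?thesis
      using dir_inner_g_le[OF t \<omega>] \<mu>
      by (intro add_left_mono mult_left_mono) (auto simp: r_def d_def)
  qed
  also have "\<dots> = f (x t \<omega>) + \<mu> t * (1 / r * e\<^sup>2) - \<mu> t * (11/16 * (r * d\<^sup>2))"
    by (simp add: algebra_simps)
  finally show ?thesis by (simp add: r_def e_def d_def)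
qed

text \<open>A count of coefficients. For the squared error in units of \<mu>/r, with r =
  \<rho>/\<gamma>, descent gives +1, the drift -8 and progress +1/2. For the squared direction in
  units of \<mu> r they give -11/16, +1/8 and +1/2. Both totals are negative.\<close>

lemma gap_drift_le:
  assumes t: "t \<ge> 1" and \<omega>: "\<omega> \<in> space M" and step: "8 * L * \<gamma> * \<mu> t \<le> \<rho> * \<alpha> (Suc t)"
  shows "gap (Suc t) \<omega> + 1 / L * (norm (drift t \<omega>))\<^sup>2 + \<mu> t / 2 * progress t \<omega>
    \<le> gap t \<omega> + 1 / L * (norm (err t \<omega>))\<^sup>2"
proof -
  define r where "r = \<rho> / \<gamma>"
  define e where "e = norm (err t \<omega>)"
  define d where "d = norm (dir t \<omega>)"
  define a where "a = \<alpha> (Suc t)"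
  have r: "r > 0" using rho gamma by (simp add: r_def)
  have \<mu>: "\<mu> t > 0" using mu[OF t] by simp
  have a: "0 < a" "a \<le> 1" using alpha_Suc[OF t] by (auto simp: a_def)
  have step': "8 * L * \<mu> t \<le> r * a" using step gamma by (simp add: r_def a_def field_simps)
  have "\<rho> * \<alpha> (Suc t) \<le> \<rho>" using rho alpha_Suc[OF t] by simp
  then have desc: "gap (Suc t) \<omega> \<le> gap t \<omega> + \<mu> t * (1 / r * e\<^sup>2) - \<mu> t * (11/16 * (r * d\<^sup>2))"
    using descent[OF t \<omega>] step by (simp add: gap_def r_def e_def d_def)
  have "1 / L * (norm (drift t \<omega>))\<^sup>2 \<le> 1 / L * ((1 - a) * e\<^sup>2 + (L * \<mu> t * d)\<^sup>2 / a)"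
    using norm_drift_le[OF t \<omega>] L unfolding a_def e_def d_def by (intro mult_left_mono) auto
  also have "\<dots> = 1 / L * e\<^sup>2 - a / L * e\<^sup>2 + (L * \<mu> t / a) * (\<mu> t * d\<^sup>2)"
    using L a by (simp add: field_simps power2_eq_square)
  also have "\<dots> \<le> 1 / L * e\<^sup>2 - 8 * \<mu> t / r * e\<^sup>2 + (r / 8) * (\<mu> t * d\<^sup>2)"
  proof -
    \<comment> \<open>Both are rearrangements of the step condition: the contraction is strong
      enough against the error left by descent, and the price 1/\<alpha> on the direction stays
      small.\<close>
    have "8 * \<mu> t / r \<le> a / L" "L * \<mu> t / a \<le> r / 8"
      using step' L r a by (simp_all add: field_simps)
    then have "8 * \<mu> t / r * e\<^sup>2 \<le> a / L * e\<^sup>2" "(L * \<mu> t / a) * (\<mu> t * d\<^sup>2) \<le> (r / 8) * (\<mu> t * d\<^sup>2)"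
      using \<mu> by (intro mult_right_mono; simp)+
    then show ?thesis by linarith
  qed
  finally have drift: "1 / L * (norm (drift t \<omega>))\<^sup>2 \<le> 1 / L * e\<^sup>2 - 8 * (\<mu> t * (1 / r * e\<^sup>2)) + 1/8 * (\<mu> t * (r * d\<^sup>2))"
    by (simp add: field_simps)
  have "progress t \<omega> = 1 / r * e\<^sup>2 + r * d\<^sup>2" by (simp add: progress_def r_def e_def d_def)
  then have "\<mu> t / 2 * progress t \<omega> = 1/2 * (\<mu> t * (1 / r * e\<^sup>2)) + 1/2 * (\<mu> t * (r * d\<^sup>2))"
    by (simp add: field_simps)
  moreover have "0 \<le> \<mu> t * (1 / r * e\<^sup>2)" "0 \<le> \<mu> t * (r * d\<^sup>2)" using \<mu> r by simp_all
  ultimately show ?thesis using desc drift unfolding e_def[symmetric] by linarith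
qed

section \<open>Expected decrease of the potential and telescoping\<close>

lemma potential_step:
  assumes t: "t \<ge> 1" and step: "8 * L * \<gamma> * \<mu> t \<le> \<rho> * \<alpha> (Suc t)"
  shows "potential (Suc t) + ennreal (\<mu> t / 2) * (\<integral>\<^sup>+\<omega>. ennreal (progress t \<omega>) \<partial>M)
    \<le> potential t + ennreal (\<sigma>\<^sup>2 / L * (\<alpha> (Suc t))\<^sup>2)"
proof -
  have meas [measurable]: "gap t \<in> borel_measurable M" "gap (Suc t) \<in> borel_measurable M"
      "drift t \<in> borel_measurable M" "progress t \<in> borel_measurable M" "err t \<in> borel_measurable M"
    using t by simp_all
  have \<mu>: "\<mu> t > 0" using mu[OF t] by simp
  let ?gap = "\<integral>\<^sup>+\<omega>. ennreal (gap (Suc t) \<omega>) \<partial>M"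
  let ?prog = "ennreal (\<mu> t / 2) * (\<integral>\<^sup>+\<omega>. ennreal (progress t \<omega>) \<partial>M)"
  let ?noise = "ennreal (\<sigma>\<^sup>2 / L * (\<alpha> (Suc t))\<^sup>2)"
  \<comment> \<open>Only the new error needs the fresh sample averaged out; once it is replaced by
    drift and noise, the pathwise inequality can be integrated. Gains are kept as summands on the
    left, since subtraction is unsafe for infinite values.\<close>
  have "potential (Suc t) \<le> ?gap + ennreal (1 / L) *
      ((\<integral>\<^sup>+\<omega>. ennreal ((norm (drift t \<omega>))\<^sup>2) \<partial>M) + ennreal ((\<alpha> (Suc t))\<^sup>2 * \<sigma>\<^sup>2))"
    unfolding potential_def by (intro add_left_mono mult_left_mono nn_integral_err_Suc[OF t]) simp
  also have "\<dots> = ?gap + ennreal (1 / L) * (\<integral>\<^sup>+\<omega>. ennreal ((norm (drift t \<omega>))\<^sup>2) \<partial>M) + ?noise"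
    using L by (simp add: distrib_left ennreal_mult[symmetric] add.assoc mult.commute)
  finally have "potential (Suc t) + ?prog
      \<le> ?gap + ennreal (1 / L) * (\<integral>\<^sup>+\<omega>. ennreal ((norm (drift t \<omega>))\<^sup>2) \<partial>M) + ?noise + ?prog"
    by (rule add_right_mono)
  also have "\<dots> = (\<integral>\<^sup>+\<omega>. ennreal (gap (Suc t) \<omega>) + ennreal (1 / L) * ennreal ((norm (drift t \<omega>))\<^sup>2)
      + ennreal (\<mu> t / 2) * ennreal (progress t \<omega>) \<partial>M) + ?noise"
    by (simp add: nn_integral_add nn_integral_cmult ac_simps)
  also have "\<dots> \<le> (\<integral>\<^sup>+\<omega>. ennreal (gap t \<omega>) + ennreal (1 / L) * ennreal ((norm (err t \<omega>))\<^sup>2) \<partial>M) + ?noise"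
  proof (intro add_right_mono nn_integral_mono)
    fix \<omega> assume "\<omega> \<in> space M"
    from gap_drift_le[OF t this step]
    show "ennreal (gap (Suc t) \<omega>) + ennreal (1 / L) * ennreal ((norm (drift t \<omega>))\<^sup>2)
        + ennreal (\<mu> t / 2) * ennreal (progress t \<omega>)
        \<le> ennreal (gap t \<omega>) + ennreal (1 / L) * ennreal ((norm (err t \<omega>))\<^sup>2)"
      using L \<mu> gap_nonneg progress_nonneg
      by (simp add: ennreal_mult[symmetric] ennreal_plus[symmetric] ennreal_leI del: ennreal_plus)
  qed
  also have "\<dots> = potential t + ?noise"
    by (simp add: potential_def nn_integral_add nn_integral_cmult)
  finally show ?thesis .
qed

lemma potential_1_le: "potential 1 \<le> ennreal (f x1 - (INF y. f y) + \<sigma>\<^sup>2 / L)"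
proof -
  have "(\<integral>\<^sup>+\<omega>. ennreal (gap 1 \<omega>) \<partial>M) = (\<integral>\<^sup>+\<omega>. ennreal (f x1 - (INF y. f y)) \<partial>M)"
    by (intro nn_integral_cong) (simp add: gap_def x_start del: One_nat_def)
  then have "potential 1 \<le> ennreal (f x1 - (INF y. f y)) + ennreal (1 / L) * ennreal (\<sigma>\<^sup>2)"
    unfolding potential_def using nn_integral_err_1
    by (auto simp: emeasure_space_1 intro!: mult_left_mono)
  then show ?thesis
    using L cINF_lower[OF bounded_below, of x1] by (simp add: ennreal_mult[symmetric] ennreal_plus[symmetric] del: ennreal_plus)
qed

lemma potential_telescope:
  assumes step: "\<And>t. t \<ge> 1 \<Longrightarrow> 8 * L * \<gamma> * \<mu> t \<le> \<rho> * \<alpha> (Suc t)"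
  shows "potential (Suc T) + (\<Sum>t = 1..T. ennreal (\<mu> t / 2) * (\<integral>\<^sup>+\<omega>. ennreal (progress t \<omega>) \<partial>M))
    \<le> potential 1 + ennreal (\<sigma>\<^sup>2 / L * (\<Sum>t = 1..T. (\<alpha> (Suc t))\<^sup>2))"
proof (induction T)
  case (Suc T)
  let ?P = "\<lambda>t. ennreal (\<mu> t / 2) * (\<integral>\<^sup>+\<omega>. ennreal (progress t \<omega>) \<partial>M)"
  have "potential (Suc (Suc T)) + (\<Sum>t = 1..Suc T. ?P t)
      = (potential (Suc (Suc T)) + ?P (Suc T)) + (\<Sum>t = 1..T. ?P t)"
    by (simp add: ac_simps)
  also have "\<dots> \<le> (potential (Suc T) + ennreal (\<sigma>\<^sup>2 / L * (\<alpha> (Suc (Suc T)))\<^sup>2)) + (\<Sum>t = 1..T. ?P t)"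
    by (intro add_right_mono potential_step step) auto
  also have "\<dots> = (potential (Suc T) + (\<Sum>t = 1..T. ?P t)) + ennreal (\<sigma>\<^sup>2 / L * (\<alpha> (Suc (Suc T)))\<^sup>2)"
    by (simp add: ac_simps)
  also have "\<dots> \<le> (potential 1 + ennreal (\<sigma>\<^sup>2 / L * (\<Sum>t = 1..T. (\<alpha> (Suc t))\<^sup>2)))
      + ennreal (\<sigma>\<^sup>2 / L * (\<alpha> (Suc (Suc T)))\<^sup>2)"
    by (intro add_right_mono Suc.IH)
  also have "\<dots> = potential 1 + ennreal (\<sigma>\<^sup>2 / L * (\<Sum>t = 1..Suc T. (\<alpha> (Suc t))\<^sup>2))"
    using L by (simp add: add.assoc ennreal_plus[symmetric] sum_nonneg distrib_left del: ennreal_plus)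
  finally show ?case .
qed simp

text \<open>The smallest weight \<open>\<mu> T\<close> is pulled out of the telescoped sum, and the
  terminal potential is dropped because it is nonnegative.\<close>

lemma sum_nn_integral_progress_le:
  assumes step: "\<And>t. t \<ge> 1 \<Longrightarrow> 8 * L * \<gamma> * \<mu> t \<le> \<rho> * \<alpha> (Suc t)"
    and T: "T \<ge> 1" and \<mu>: "\<And>t. t \<in> {1..T} \<Longrightarrow> \<mu> T \<le> \<mu> t"
  shows "(\<Sum>t = 1..T. \<integral>\<^sup>+\<omega>. ennreal (progress t \<omega>) \<partial>M)
    \<le> ennreal (2 / \<mu> T * (f x1 - (INF y. f y) + \<sigma>\<^sup>2 / L * (1 + (\<Sum>t = 1..T. (\<alpha> (Suc t))\<^sup>2))))"
proof -
  have \<mu>T: "\<mu> T > 0" using mu[OF T] by simp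
  have gap: "0 \<le> f x1 - (INF y. f y)" using cINF_lower[OF bounded_below, of x1] by simp
  have "(\<Sum>t = 1..T. \<integral>\<^sup>+\<omega>. ennreal (progress t \<omega>) \<partial>M)
      = ennreal (2 / \<mu> T) * (\<Sum>t = 1..T. ennreal (\<mu> T / 2) * (\<integral>\<^sup>+\<omega>. ennreal (progress t \<omega>) \<partial>M))"
    using \<mu>T by (simp add: sum_distrib_left[symmetric] mult.assoc[symmetric] ennreal_mult[symmetric])
  also have "\<dots> \<le> ennreal (2 / \<mu> T) * (\<Sum>t = 1..T. ennreal (\<mu> t / 2) * (\<integral>\<^sup>+\<omega>. ennreal (progress t \<omega>) \<partial>M))"
    using \<mu> by (intro mult_left_mono sum_mono mult_right_mono ennreal_leI) auto
  also have "\<dots> \<le> ennreal (2 / \<mu> T) * (potential 1 + ennreal (\<sigma>\<^sup>2 / L * (\<Sum>t = 1..T. (\<alpha> (Suc t))\<^sup>2)))"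
    by (intro mult_left_mono order.trans[OF _ potential_telescope[OF step]]) auto
  also have "\<dots> \<le> ennreal (2 / \<mu> T) * (ennreal (f x1 - (INF y. f y) + \<sigma>\<^sup>2 / L) + ennreal (\<sigma>\<^sup>2 / L * (\<Sum>t = 1..T. (\<alpha> (Suc t))\<^sup>2)))"
    by (intro mult_left_mono add_right_mono potential_1_le) auto
  also have "\<dots> = ennreal (2 / \<mu> T * (f x1 - (INF y. f y) + \<sigma>\<^sup>2 / L * (1 + (\<Sum>t = 1..T. (\<alpha> (Suc t))\<^sup>2))))"
    using L \<mu>T gap
    by (subst ennreal_plus[symmetric])
       (auto simp: ennreal_mult[symmetric] sum_nonneg distrib_left add.assoc simp del: ennreal_plus)
  finally show ?thesis .
qed

section \<open>From progress to gradient norms\<close>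

definition residual :: "nat \<Rightarrow> 'w \<Rightarrow> real" where
  "residual t \<omega> = norm (err t \<omega>) / \<rho> + norm (dir t \<omega>) / \<gamma>"

text \<open>The gradient is error plus estimator. Optimality writes the estimator through
  \<open>H t\<close> applied to the direction, and
  \<open>\<rho> \<le> spectral_norm (H t \<omega>)\<close> gives the error the same factor, ready
  for Cauchy-Schwarz.\<close>

lemma norm_gradient_le:
  assumes t: "t \<ge> 1" and \<omega>: "\<omega> \<in> space M"
  shows "norm (gradient f (x t \<omega>)) \<le> spectral_norm (H t \<omega>) * residual t \<omega>"
proof -
  have S: "\<rho> \<le> spectral_norm (H t \<omega>)" by (rule spectral_norm_ge[OF H_lower[OF t \<omega>]])
  have "\<gamma> * norm (g t \<omega>) = norm (H t \<omega> *v dir t \<omega>)"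
    using gamma by (simp add: newton_step[OF t \<omega>])
  also have "\<dots> \<le> spectral_norm (H t \<omega>) * norm (dir t \<omega>)"
    by (rule norm_matrix_vector_le_spectral_norm)
  finally have g: "norm (g t \<omega>) \<le> spectral_norm (H t \<omega>) * (norm (dir t \<omega>) / \<gamma>)"
    using gamma by (simp add: field_simps)
  have "\<rho> * (norm (err t \<omega>) / \<rho>) \<le> spectral_norm (H t \<omega>) * (norm (err t \<omega>) / \<rho>)"
    using S rho by (intro mult_right_mono) auto
  then have e: "norm (err t \<omega>) \<le> spectral_norm (H t \<omega>) * (norm (err t \<omega>) / \<rho>)"
    using rho by simp
  have "norm (gradient f (x t \<omega>)) \<le> norm (err t \<omega>) + norm (g t \<omega>)"
    using norm_triangle_ineq[of "err t \<omega>" "g t \<omega>"] by (simp add: err_def)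
  with e g show ?thesis by (simp add: residual_def distrib_left)
qed

text \<open>After splitting the square of the sum, the weights of \<open>progress\<close> are
  exactly those that leave one common factor for both terms.\<close>

lemma residual_square_le: "(residual t \<omega>)\<^sup>2 \<le> 2 / (\<rho> * \<gamma>) * progress t \<omega>"
proof -
  have "(residual t \<omega>)\<^sup>2 \<le> 2 * (norm (err t \<omega>) / \<rho>)\<^sup>2 + 2 * (norm (dir t \<omega>) / \<gamma>)\<^sup>2"
    using zero_le_power2[of "norm (err t \<omega>) / \<rho> - norm (dir t \<omega>) / \<gamma>"]
    by (simp add: residual_def power2_sum power2_diff)
  also have "\<dots> = 2 / (\<rho> * \<gamma>) * progress t \<omega>"
    using gamma rho by (simp add: progress_def field_simps power2_eq_square)
  finally show ?thesis .
qed

lemma sum_nn_integral_gradient_le: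
  assumes step: "\<And>t. t \<ge> 1 \<Longrightarrow> 8 * L * \<gamma> * \<mu> t \<le> \<rho> * \<alpha> (Suc t)"
    and T: "T \<ge> 1" and \<mu>: "\<And>t. t \<in> {1..T} \<Longrightarrow> \<mu> T \<le> \<mu> t"
    and b: "2 / (\<rho> * \<gamma>) * (2 / \<mu> T * (f x1 - (INF y. f y) + \<sigma>\<^sup>2 / L * (1 + (\<Sum>t = 1..T. (\<alpha> (Suc t))\<^sup>2)))) \<le> b" "0 < b"
    and a: "(\<Sum>t = 1..T. \<integral>\<^sup>+\<omega>. ennreal ((spectral_norm (H t \<omega>))\<^sup>2) \<partial>M) \<le> ennreal a" "0 < a"
  shows "(\<Sum>t = 1..T. \<integral>\<^sup>+\<omega>. ennreal (norm (gradient f (x t \<omega>))) \<partial>M) \<le> ennreal (sqrt (a * b))"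
proof -
  have res [measurable]: "residual t \<in> borel_measurable M" if "t \<in> {1..T}" for t
  proof -
    have [measurable]: "err t \<in> borel_measurable M" "dir t \<in> borel_measurable M"
      using that by simp_all
    show ?thesis unfolding residual_def[abs_def] by measurable
  qed
  have "(\<Sum>t = 1..T. \<integral>\<^sup>+\<omega>. ennreal ((residual t \<omega>)\<^sup>2) \<partial>M)
      \<le> (\<Sum>t = 1..T. \<integral>\<^sup>+\<omega>. ennreal (2 / (\<rho> * \<gamma>)) * ennreal (progress t \<omega>) \<partial>M)"
    using rho gamma progress_nonneg residual_square_le
    by (intro sum_mono nn_integral_mono) (simp add: ennreal_mult[symmetric] ennreal_leI)
  also have "\<dots> = ennreal (2 / (\<rho> * \<gamma>)) * (\<Sum>t = 1..T. \<integral>\<^sup>+\<omega>. ennreal (progress t \<omega>) \<partial>M)"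
    unfolding sum_distrib_left by (intro sum.cong refl nn_integral_cmult) auto
  also have "\<dots> \<le> ennreal (2 / (\<rho> * \<gamma>)) * ennreal (2 / \<mu> T * (f x1 - (INF y. f y)
      + \<sigma>\<^sup>2 / L * (1 + (\<Sum>t = 1..T. (\<alpha> (Suc t))\<^sup>2))))"
    by (intro mult_left_mono sum_nn_integral_progress_le[OF step T \<mu>]) auto
  also have "\<dots> \<le> ennreal b"
    using b rho gamma by (subst ennreal_mult'[symmetric]) (auto intro: ennreal_leI)
  finally have w: "(\<Sum>t = 1..T. \<integral>\<^sup>+\<omega>. ennreal ((residual t \<omega>)\<^sup>2) \<partial>M) \<le> ennreal b" .
  have "(\<Sum>t = 1..T. \<integral>\<^sup>+\<omega>. ennreal (norm (gradient f (x t \<omega>))) \<partial>M)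
      \<le> (\<Sum>t = 1..T. \<integral>\<^sup>+\<omega>. ennreal (spectral_norm (H t \<omega>) * residual t \<omega>) \<partial>M)"
    by (intro sum_mono nn_integral_mono ennreal_leI norm_gradient_le) auto
  also have "\<dots> \<le> ennreal (sqrt (a * b))"
    by (rule sum_nn_integral_mult_le[OF _ _ a w b(2)]) auto
  finally show ?thesis .
qed

end

subsection \<open>Convergence rate\<close>

theorem corollary2:
  fixes M :: "'w measure" and D :: "'s measure"
    and F :: "real ^ 'd \<Rightarrow> 's \<Rightarrow> real" and f :: "real ^ 'd \<Rightarrow> real"
    and \<xi> :: "nat \<Rightarrow> 'w \<Rightarrow> 's" and H :: "nat \<Rightarrow> 'w \<Rightarrow> real ^ 'd ^ 'd"
    and xt x g :: "nat \<Rightarrow> 'w \<Rightarrow> real ^ 'd" and x1 :: "real ^ 'd"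
    and \<mu> \<alpha> :: "nat \<Rightarrow> real" and \<sigma> \<rho> L k m \<nu> \<gamma> c M' :: real and T :: nat
  assumes algorithm: "super_adam M D F UNIV 0 \<gamma> \<mu> \<alpha> x1 \<xi> H xt x g"
    and objective: "\<And>y. has_bochner_integral D (F y) (f y)"
    and F_differentiable: "\<And>s y. s \<in> space D \<Longrightarrow> (\<lambda>z. F z s) differentiable (at y)"
    and f_differentiable: "\<And>y. f differentiable (at y)"
    and sigma: "\<sigma> > 0"
    and unbiased: "\<And>y. has_bochner_integral D (\<lambda>s. gradient (\<lambda>z. F z s) y) (gradient f y)"
    and variance:
      "\<And>y. (\<integral>\<^sup>+s. ennreal ((norm (gradient (\<lambda>z. F z s) y - gradient f y))\<^sup>2) \<partial>D) \<le> ennreal (\<sigma>\<^sup>2)"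
    and bounded_below: "bdd_below (range f)"
    and rho: "\<rho> > 0"
    and H_lower:
      "\<And>t \<omega>. t \<ge> 1 \<Longrightarrow> \<omega> \<in> space M \<Longrightarrow> pos_semidef (H t \<omega> - \<rho> *\<^sub>R mat 1)"
    and L: "L > 0"
    and smooth: "\<And>y z. norm (gradient f y - gradient f z) \<le> L * norm (y - z)"
    and k: "k > 0"
    and m: "m \<ge> k\<^sup>2"
    and nu: "\<nu> \<ge> 8"
    and gamma: "\<gamma> = \<rho> * sqrt m / (\<nu> * L * k)"
    and c_lower: "8 * L * \<gamma> / \<rho> \<le> c"
    and c_upper: "c \<le> sqrt m / k"
    and mu: "\<And>t. \<mu> t = k / sqrt (m + real t)"
    and alpha: "\<And>t. \<alpha> (t + 1) = c * \<mu> t"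
    and M': "M' = \<nu> * L * (f x1 - (INF y. f y)) + 2 * \<nu> * \<sigma>\<^sup>2 + 2 * \<nu> * m * \<sigma>\<^sup>2 * ln (m + real T)"
    and T: "T \<ge> 1"
  shows "(\<Sum>t = 1..T. \<integral>\<^sup>+\<omega>. ennreal (norm (gradient f (x t \<omega>))) \<partial>M) / of_nat T
    \<le> ennreal_sqrt ((\<Sum>t = 1..T. \<integral>\<^sup>+\<omega>. ennreal ((spectral_norm (H t \<omega>))\<^sup>2) \<partial>M) / of_nat T)
        / ennreal \<rho>
      * ennreal (2 * sqrt (2 * M') / sqrt (real T)
                 + 2 * sqrt (2 * M') / (m powr (1/4) * real T powr (1/4)))"
proof -
  interpret SA: super_adam_zero M D F \<gamma> \<mu> \<alpha> x1 \<xi> H xt x g f \<sigma> \<rho> L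
    using algorithm objective F_differentiable f_differentiable unbiased variance bounded_below
      rho H_lower L smooth
    by (intro super_adam_zero.intro super_adam_zero_axioms.intro)
  define G where "G = f x1 - (INF y. f y)"
  define R where "R = (\<Sum>t = 1..T. \<integral>\<^sup>+\<omega>. ennreal ((spectral_norm (H t \<omega>))\<^sup>2) \<partial>M)"
  \<comment> \<open>\<open>8 * M'\<close> is the square of the constant
    \<open>2 * sqrt (2 * M')\<close> in the claim. The estimate below produces only
    \<open>4 * M'\<close>, so a factor of two is to spare.\<close>
  define b where "b = 8 * M' / \<rho>\<^sup>2 * (1 + sqrt (real T / m))"
  have m0: "m > 0" using m k by (smt (verit) zero_less_power)
  have G: "G \<ge> 0" unfolding G_def using cINF_lower[OF bounded_below, of x1] by simp
  have ln: "0 \<le> ln (m + real T)" using m0 T by simp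
  have M'_eq: "M' = \<nu> * L * G + 2 * \<nu> * \<sigma>\<^sup>2 + 2 * \<nu> * m * \<sigma>\<^sup>2 * ln (m + real T)"
    using M' by (simp add: G_def)
  have "0 < 2 * \<nu> * \<sigma>\<^sup>2" "0 \<le> \<nu> * L * G" "0 \<le> 2 * \<nu> * m * \<sigma>\<^sup>2 * ln (m + real T)"
    using nu sigma L G m0 ln by simp_all
  then have M'_pos: "M' > 0" unfolding M'_eq by linarith
  have b_pos: "b > 0" unfolding b_def using M'_pos rho m0 by (intro mult_pos_pos add_pos_nonneg) auto
  have step: "8 * L * \<gamma> * \<mu> t \<le> \<rho> * \<alpha> (Suc t)" if "t \<ge> 1" for t
  proof -
    have "8 * L * \<gamma> \<le> \<rho> * c" using c_lower rho by (simp add: field_simps)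
    moreover have "0 < \<mu> t" using SA.mu[OF that] by simp
    ultimately have "8 * L * \<gamma> * \<mu> t \<le> \<rho> * c * \<mu> t" by (intro mult_right_mono) auto
    then show ?thesis using alpha[of t] by (simp add: mult.assoc)
  qed
  have mu_antimono: "\<mu> T \<le> \<mu> t" if "t \<in> {1..T}" for t
    unfolding mu using that k m0 by (intro divide_left_mono) auto
  \<comment> \<open>The upper bound on \<open>c\<close> means \<open>c * k \<le> sqrt m\<close>, so
    each squared weight is at most a term of the shifted harmonic sum.\<close>
  have "(\<Sum>t = 1..T. (\<alpha> (Suc t))\<^sup>2) \<le> (\<Sum>t = 1..T. m / (m + real t))"
  proof (intro sum_mono)
    fix t
    have "c \<ge> 0"
      using c_lower L rho SA.gamma by (smt (verit) divide_nonneg_pos mult_nonneg_nonneg)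
    then have "(c * k)\<^sup>2 \<le> (sqrt m)\<^sup>2"
      using c_upper k by (intro power_mono) (auto simp: field_simps)
    then show "(\<alpha> (Suc t))\<^sup>2 \<le> m / (m + real t)"
      using alpha[of t] m0 by (simp add: mu power_divide divide_right_mono)
  qed
  also have "\<dots> \<le> 1 + m * ln (m + real T)" by (rule sum_shifted_harmonic_le_ln[OF m0 T])
  finally have sum_alpha: "(\<Sum>t = 1..T. (\<alpha> (Suc t))\<^sup>2) \<le> 1 + m * ln (m + real T)" .
  have budget: "2 / (\<rho> * \<gamma>) * (2 / \<mu> T * (G + \<sigma>\<^sup>2 / L * (1 + (\<Sum>t = 1..T. (\<alpha> (Suc t))\<^sup>2)))) \<le> b"
  proof -
    let ?A = "\<Sum>t = 1..T. (\<alpha> (Suc t))\<^sup>2"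
    \<comment> \<open>Inserting \<gamma> and \<open>\<mu> T\<close> cancels \<open>k\<close> and
      leaves the ratio of \<open>sqrt (m + real T)\<close> to \<open>sqrt m\<close>; the factor
      \<open>\<nu> * L\<close> of 1/\<gamma> turns the bracket into the shape of
      \<open>M'\<close>.\<close>
    have "2 / (\<rho> * \<gamma>) * (2 / \<mu> T * (G + \<sigma>\<^sup>2 / L * (1 + ?A)))
        = 4 / \<rho>\<^sup>2 * (sqrt (m + real T) / sqrt m) * (\<nu> * L * G + \<nu> * \<sigma>\<^sup>2 * (1 + ?A))"
    proof -
      have "2 / (\<rho> * \<gamma>) = 2 * \<nu> * L * k / (\<rho>\<^sup>2 * sqrt m)"
        unfolding gamma using rho L k nu m0 by (simp add: power2_eq_square)
      moreover have "2 / \<mu> T = 2 * sqrt (m + real T) / k"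
        unfolding mu by simp
      moreover have "\<nu> * L * (G + \<sigma>\<^sup>2 / L * (1 + ?A)) = \<nu> * L * G + \<nu> * \<sigma>\<^sup>2 * (1 + ?A)"
        using L by (simp add: field_simps)
      moreover have "2 * \<nu> * L * k / (\<rho>\<^sup>2 * sqrt m) * (2 * sqrt (m + real T) / k * (G + \<sigma>\<^sup>2 / L * (1 + ?A)))
          = 4 / \<rho>\<^sup>2 * (sqrt (m + real T) / sqrt m) * (\<nu> * L * (G + \<sigma>\<^sup>2 / L * (1 + ?A)))"
        using k by simp
      ultimately show ?thesis by (simp only:)
    qed
    also have "\<dots> \<le> 4 / \<rho>\<^sup>2 * (1 + sqrt (real T / m)) * M'"
    proof (intro mult_mono mult_left_mono)
      have "sqrt (m + real T) / sqrt m = sqrt (1 + real T / m)"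
        using m0 by (simp add: add_divide_distrib flip: real_sqrt_divide)
      also have "\<dots> \<le> 1 + sqrt (real T / m)"
        using sqrt_add_le_add_sqrt[of 1 "real T / m"] m0 by simp
      finally show "sqrt (m + real T) / sqrt m \<le> 1 + sqrt (real T / m)" .
      \<comment> \<open>The logarithm is nonnegative since \<open>m + real T\<close> exceeds 1, so
        its coefficient may be doubled to match \<open>M'\<close>.\<close>
      have "\<nu> * \<sigma>\<^sup>2 * (1 + ?A) \<le> \<nu> * \<sigma>\<^sup>2 * (2 + 2 * (m * ln (m + real T)))"
        using sum_alpha nu m0 ln by (intro mult_left_mono) (auto intro: order.trans)
      then show "\<nu> * L * G + \<nu> * \<sigma>\<^sup>2 * (1 + ?A) \<le> M'"
        unfolding M'_eq by (simp add: algebra_simps)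
      show "0 \<le> \<nu> * L * G + \<nu> * \<sigma>\<^sup>2 * (1 + ?A)"
        using nu L G by (simp add: sum_nonneg)
    qed (use m0 in auto)
    also have "\<dots> \<le> b"
      unfolding b_def using M'_pos m0 rho by (simp add: field_simps)
    finally show ?thesis .
  qed
  let ?K = "2 * sqrt (2 * M') / sqrt (real T) + 2 * sqrt (2 * M') / (m powr (1/4) * real T powr (1/4))"
  have K: "?K > 0" using M'_pos T m0 by (intro add_pos_pos divide_pos_pos mult_pos_pos) auto
  show ?thesis
  proof (cases "R = \<infinity>")
    case True
    \<comment> \<open>An infinite second moment makes the bound trivial. Strict positivity of
      \<open>?K\<close> matters, since zero times infinity is zero in
      \<open>ennreal\<close>.\<close>
    then have "ennreal_sqrt (R / of_nat T) / ennreal \<rho> * ennreal ?K = \<infinity>"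
      using K by (simp add: ennreal_sqrt_def ennreal_divide_eq_top_iff ennreal_top_divide ennreal_top_mult)
    then show ?thesis by (simp only: R_def[symmetric]) simp
  next
    case False
    then obtain a where a: "R = ennreal a" "a \<ge> 0" by (cases R) auto
    \<comment> \<open>The single term at index \<open>T\<close> already bounds \<open>R\<close>
      below by \<open>\<rho>\<^sup>2\<close>, which gives the strict positivity that the
      Cauchy-Schwarz weight requires.\<close>
    have "ennreal (\<rho>\<^sup>2) = (\<integral>\<^sup>+\<omega>. ennreal (\<rho>\<^sup>2) \<partial>M)" by (simp add: SA.emeasure_space_1)
    also have "\<dots> \<le> (\<integral>\<^sup>+\<omega>. ennreal ((spectral_norm (H T \<omega>))\<^sup>2) \<partial>M)"
      using T rho spectral_norm_ge[OF H_lower[OF T]]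
      by (intro nn_integral_mono ennreal_leI power_mono) auto
    also have "\<dots> \<le> R" unfolding R_def using T by (intro member_le_sum) auto
    finally have "\<rho>\<^sup>2 \<le> a" unfolding a(1) using a(2) by simp
    then have a_pos: "a > 0" using rho by (smt (verit) zero_less_power)
    have "(\<Sum>t = 1..T. \<integral>\<^sup>+\<omega>. ennreal (norm (gradient f (x t \<omega>))) \<partial>M) / of_nat T
        \<le> ennreal (sqrt (a * b)) / of_nat T"
      using SA.sum_nn_integral_gradient_le[OF step T mu_antimono budget[unfolded G_def] b_pos _ a_pos] a
      by (intro divide_right_mono_ennreal) (auto simp: R_def)
    also have "\<dots> = ennreal (sqrt (a * b) / real T)"
      using T a b_pos by (simp add: ennreal_of_nat_eq_real_of_nat divide_ennreal)
    also have "\<dots> \<le> ennreal (sqrt (a / real T) / \<rho> * ?K)"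
      unfolding b_def using m0 T rho a M'_pos by (intro ennreal_leI sqrt_rate_le) auto
    also have "\<dots> = ennreal (sqrt (a / real T) / \<rho>) * ennreal ?K"
      using a rho K by (intro ennreal_mult) auto
    also have "\<dots> = ennreal_sqrt (R / of_nat T) / ennreal \<rho> * ennreal ?K"
      using T a rho by (simp add: ennreal_of_nat_eq_real_of_nat divide_ennreal ennreal_sqrt_ennreal)
    finally show ?thesis unfolding R_def .
  qed
qed

end
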